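(* Let $Q$ be a quiver without loops and 2-cycles, let $k$ be a vertex of $Q$, and fix a maximal matching at $k$, with subset of arrows $\Gamma'$ and corresponding subset of pairs $C'=\{(\alpha_\gamma,\beta_\gamma):\gamma\in\Gamma'\}\subseteq C$. Let $S$ be a potential on $Q$ such that no term of $S$ starts at $k$ and none of the paths $\alpha\beta$ with $(\alpha,\beta)\in C'$ appears in $S$. Let $S^*$ be the potential on $\mu_k(Q)$ obtained from $S$ by replacing each path $\alpha\beta$ with $(\alpha,\beta)\in C\setminus C'$ occurring in $S$ by the arrow $[\alpha\beta]$, and each occurrence of an arrow $\gamma\in\Gamma'$ by $-\beta_\gamma^*\alpha_\gamma^*$. Then, up to right equivalence, $$\mu_k\Bigl(Q,\ \sum_{\gamma\in\Gamma'}\alpha_\gamma\beta_\gamma\gamma+S\Bigr)=\Bigl(\mu_k(Q),\ \sum_{(\alpha,\beta)\in C\setminus C'}[\alpha\beta]\beta^*\alpha^*+S^*\Bigr).$$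
   Context: **Quivers with potentials.** $K$ is a field. A quiver is a finite directed graph; paths are composed left to right. $\widehat{KQ}$ is the completion of the path algebra $KQ$ at the ideal generated by the arrows; $e_i$ is the lazy path at $i$. A potential is a (possibly infinite) linear combination of cycles of length at least $2$; it is reduced if all its cycles have length at least $3$. Two potentials are cyclically equivalent if their difference lies in the closure of the span of commutators of $\widehat{KQ}$. Quivers with potential $(Q,W)$, $(Q',W')$ on the same vertex set are right equivalent if there is an algebra isomorphism $\varphi:\widehat{KQ}\to\widehat{KQ'}$ with $\varphi(e_i)=e_i$ for all $i$ and $\varphi(W)$ cyclically equivalent to $W'$. The direct sum $(Q',W')\oplus(Q'',W'')$ has the same vertices, the disjoint union of the arrows, and potential $W'+W''$. A (loop-free) $(Q,W)$ is trivial if the arrows of $Q$ are $2n$ distinct arrows $\alpha_1,\dots,\alpha_n,\beta_1,\dots,\beta_n$ with each $\alpha_r\beta_r$ a 2-cycle, and $W$ is cyclically equivalent to $\varphi(\sum_r\alpha_r\beta_r)$ for an automorphism $\varphi$ of $\widehat{KQ}$ fixing all $e_i$ and mapping the span of the arrows to itself. Every loop-free $(Q,W)$ is right equivalent to the direct sum of a reduced one (its reduced part) and a trivial one, both unique up to right equivalence (Splitting Theorem). **Mutation.** Let $C$ be the set of pairs $(\alpha,\beta)$ of arrows with $\alpha$ ending at $k$ and $\beta$ starting at $k$; for vertices $i,j\ne k$ let $C_{ij}$ be the subset with $\alpha:i\to k$, $\beta:k\to j$. The pre-mutation $\widetilde\mu_k(Q)$ is obtained from $Q$ by adding an arrow $[\alpha\beta]:i\to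 j$ for each $(\alpha,\beta)\in C_{ij}$, and replacing each arrow $\alpha:i\to k$ by $\alpha^*:k\to i$ and each $\beta:k\to j$ by $\beta^*:j\to k$. The mutation $\mu_k(Q)$ is obtained from $\widetilde\mu_k(Q)$ by removing a maximal set of disjoint 2-cycles. For a potential $W$ (rotated so that no term starts at $k$), $[W]$ is obtained by replacing every occurrence of $\alpha\beta$, $(\alpha,\beta)\in C$, by $[\alpha\beta]$; $\widetilde\mu_k(Q,W)=(\widetilde\mu_k(Q),\sum_{(\alpha,\beta)\in C}[\alpha\beta]\beta^*\alpha^*+[W])$, and $\mu_k(Q,W)$ is the reduced part of $\widetilde\mu_k(Q,W)$. **Matchings.** Let $\Gamma_{ij}$ be the set of arrows from $j$ to $i$ in $Q$. A matching at $k$ consists, for each $i,j\neq k$, of subsets $C'_{ij}\subseteq C_{ij}$, $\Gamma'_{ij}\subseteq\Gamma_{ij}$ and a bijection $C'_{ij}\to\Gamma'_{ij}$; it is maximal if $|C'_{ij}|=|\Gamma'_{ij}|=\min\{|C_{ij}|,|\Gamma_{ij}|\}$ for all $i,j\ne k$. Put $C'=\bigcup C'_{ij}$, $\Gamma'=\bigcup\Gamma'_{ij}$; for $\gamma\in\Gamma'$ let $(\alpha_\gamma,\beta_\gamma)\in C'$ be the corresponding pair, so $\alpha_\gamma\beta_\gamma\gamma$ is a 3-cycle. In the claim $\mu_k(Q)$ is realised as the quiver obtained from $\widetilde\mu_k(Q)$ by removing the 2-cycles $[\alpha_\gamma\beta_\gamma]\gamma$, i.e. removing all arrows $\gamma\in\Gamma'$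 and all arrows $[\alpha\beta]$ with $(\alpha,\beta)\in C'$. *)

theory Defs
  imports
    "Graph_Theory.Digraph"
    "Graph_Theory.Arc_Walk"
    "HOL-Algebra.QuotRing"
    "HOL-Library.Function_Algebras"
    "HOL-Library.Sublist"
begin

section \<open>Complete path algebras\<close>

text \<open>
  A quiver is a \<^locale>\<open>fin_digraph\<close>. A path is a pair of its start vertex and its list of
  arrows, written from left to right; \<open>(i, [])\<close> is the lazy path at \<open>i\<close>.
\<close>

type_synonym ('v, 'a) path = "'v \<times> 'a list"
type_synonym ('v, 'a, 'k) series = "('v, 'a) path \<Rightarrow> 'k"

definition paths :: "('v, 'a) pre_digraph \<Rightarrow> ('v, 'a) path set" where
  "paths Q = {(u, w). \<exists>v. pre_digraph.awalk Q u w v}"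

definition series_scale :: "'k::field \<Rightarrow> ('p \<Rightarrow> 'k) \<Rightarrow> ('p \<Rightarrow> 'k)" where
  "series_scale c x = (\<lambda>p. c * x p)"

global_interpretation series: vector_space "series_scale :: 'k::field \<Rightarrow> ('p \<Rightarrow> 'k) \<Rightarrow> ('p \<Rightarrow> 'k)"
  by unfold_locales (auto simp: series_scale_def fun_eq_iff algebra_simps)

definition single :: "'p \<Rightarrow> 'k::field \<Rightarrow> ('p \<Rightarrow> 'k)" where
  "single p c = (\<lambda>q. if q = p then c else 0)"

definition lazy :: "'v \<Rightarrow> ('v, 'a, 'k::field) series" where
  "lazy i = single (i, []) 1"

text \<open>Only used for nonempty \<open>w\<close>.\<close>

definition path_elem :: "('v, 'a) pre_digraph \<Rightarrow> 'a list \<Rightarrow> ('v, 'a, 'k::field) series" where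
  "path_elem Q w = single (tail Q (hd w), w) 1"

text \<open>
  A finite quiver has only finitely many paths of each length, so the completion of its path
  algebra at the arrow ideal consists of all families of coefficients indexed by the paths. The
  coefficient of a product at a path is the sum over all ways to cut the path into two.
\<close>

definition series_mult ::
  "('v, 'a) pre_digraph \<Rightarrow> ('v, 'a, 'k::field) series \<Rightarrow> ('v, 'a, 'k) series \<Rightarrow> ('v, 'a, 'k) series"
where
  "series_mult Q x y =
    (\<lambda>(u, w). \<Sum>n\<le>length w. x (u, take n w) * y (pre_digraph.awlast Q u (take n w), drop n w))"

definition complete_path_algebra :: "('v, 'a) pre_digraph \<Rightarrow> ('v, 'a, 'k::field) series ring" where
  "complete_path_algebra Q =
    \<lparr>carrier = {x. \<forall>p. x p \<noteq> 0 \<longrightarrow> p \<in> paths Q},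
     monoid.mult = series_mult Q,
     one = (\<lambda>(u, w). if u \<in> verts Q \<and> w = [] then 1 else 0),
     ring.zero = 0,
     add = (+)\<rparr>"

lemma awlast_append:
  "pre_digraph.awlast Q u (p @ q) = pre_digraph.awlast Q (pre_digraph.awlast Q u p) q"
proof (induction p arbitrary: u)
  case Nil
  then show ?case by (simp add: pre_digraph.awalk_verts.simps)
next
  case (Cons e p)
  have "pre_digraph.awalk_verts Q v r \<noteq> []" for v r
    by (cases r) (simp_all add: pre_digraph.awalk_verts.simps)
  with Cons show ?case by (simp add: pre_digraph.awalk_verts.simps)
qed

lemma series_mult_assoc:
  "series_mult Q (series_mult Q x y) z = series_mult Q x (series_mult Q y z)"
proof (rule ext, clarify)
  fix u w
  let ?l = "pre_digraph.awlast Q"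
  define f where "f = (\<lambda>m n. x (u, take m w) * y (?l u (take m w), take n (drop m w)) *
      z (?l u (take (m + n) w), drop (m + n) w))"
  have "series_mult Q (series_mult Q x y) z (u, w) = (\<Sum>n\<le>length w. \<Sum>m\<le>n. f m (n - m))"
    by (auto simp: series_mult_def f_def sum_distrib_right min_def drop_take intro!: sum.cong)
  also have "\<dots> = (\<Sum>(m, n)\<in>{(m, n). m + n \<le> length w}. f m n)"
    by (rule sum.triangle_reindex_eq[symmetric])
  also have "{(m, n). m + n \<le> length w} = (SIGMA m:{..length w}. {..length w - m})"
    by auto
  also have "(\<Sum>(m, n)\<in>\<dots>. f m n) = (\<Sum>m\<le>length w. \<Sum>n\<le>length w - m. f m n)"
    by (simp add: sum.Sigma)
  also have "\<dots> = series_mult Q x (series_mult Q y z) (u, w)"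
    by (auto simp: series_mult_def f_def sum_distrib_left take_add awlast_append add.commute mult.assoc
        intro!: sum.cong)
  finally show "series_mult Q (series_mult Q x y) z (u, w) = series_mult Q x (series_mult Q y z) (u, w)" .
qed

lemma awlast_eq_if_cas:
  assumes "pre_digraph.cas Q u p v"
  shows "pre_digraph.awlast Q u p = v"
proof -
  have "pre_digraph.awalk_verts Q v r \<noteq> []" for v r
    by (cases r) (simp_all add: pre_digraph.awalk_verts.simps)
  with assms show ?thesis
    by (induction p arbitrary: u) (auto simp: pre_digraph.awalk_verts.simps pre_digraph.cas.simps)
qed

lemma series_mult_closed:
  assumes x: "x \<in> carrier (complete_path_algebra Q)" and y: "y \<in> carrier (complete_path_algebra Q)"
  shows "series_mult Q x y \<in> carrier (complete_path_algebra Q)"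
  unfolding complete_path_algebra_def
proof (simp, intro allI impI)
  fix u w
  assume "series_mult Q x y (u, w) \<noteq> 0"
  then obtain n where "n \<le> length w"
    and *: "x (u, take n w) * y (pre_digraph.awlast Q u (take n w), drop n w) \<noteq> 0"
    unfolding series_mult_def by (auto elim: sum.not_neutral_contains_not_neutral)
  let ?l = "pre_digraph.awlast Q u (take n w)"
  from * x y obtain v v' where v: "pre_digraph.awalk Q u (take n w) v"
    and v': "pre_digraph.awalk Q ?l (drop n w) v'"
    unfolding complete_path_algebra_def paths_def by fastforce
  have "?l = v" using v by (auto simp: pre_digraph.awalk_def awlast_eq_if_cas)
  have app: "pre_digraph.cas Q u (p @ q) v' \<longleftrightarrow>
      (\<exists>v. pre_digraph.cas Q u p v \<and> pre_digraph.cas Q v q v')" for u p q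
    by (induction p arbitrary: u) (auto simp: pre_digraph.cas.simps)
  have "set w = set (take n w) \<union> set (drop n w)"
    by (metis append_take_drop_id set_append)
  moreover have "pre_digraph.cas Q u w v'"
    using app[of u "take n w" "drop n w"] v v' \<open>?l = v\<close> by (auto simp: pre_digraph.awalk_def)
  ultimately have "pre_digraph.awalk Q u w v'"
    using v v' by (auto simp: pre_digraph.awalk_def)
  then show "(u, w) \<in> paths Q" by (auto simp: paths_def)
qed

lemma ring_complete_path_algebra:
  fixes Q :: "('v, 'a) pre_digraph"
  assumes "wf_digraph Q"
  shows "ring (complete_path_algebra Q :: ('v, 'a, 'k::field) series ring)"
proof (rule ringI)
  let ?A = "complete_path_algebra Q :: ('v, 'a, 'k) series ring"
  have supp: "p \<in> paths Q" if "x \<in> carrier ?A" "x p \<noteq> 0" for x p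
    using that by (cases p) (auto simp: complete_path_algebra_def)
  have lin: "x + y \<in> carrier ?A" "- x \<in> carrier ?A"
    if "x \<in> carrier ?A" "y \<in> carrier ?A" for x y
  proof -
    show "x + y \<in> carrier ?A"
      using that by (auto simp: complete_path_algebra_def) (metis add.right_neutral)
    show "- x \<in> carrier ?A"
      using that by (auto simp: complete_path_algebra_def)
  qed
  show "abelian_group ?A"
  proof (rule abelian_groupI)
    fix x assume "x \<in> carrier ?A"
    then show "\<exists>y\<in>carrier ?A. y \<oplus>\<^bsub>?A\<^esub> x = \<zero>\<^bsub>?A\<^esub>"
      using lin(2) by (intro bexI[of _ "- x"]) (auto simp: complete_path_algebra_def)
  next
    fix x y assume "x \<in> carrier ?A" "y \<in> carrier ?A"
    with lin(1)[OF this] show "x \<oplus>\<^bsub>?A\<^esub> y \<in> carrier ?A"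
      by (simp add: complete_path_algebra_def)
  qed (auto simp: complete_path_algebra_def ac_simps)
  have *: "last (pre_digraph.awalk_verts Q u []) = u" for u
    by (simp add: pre_digraph.awalk_verts.simps)
  show "Group.monoid ?A"
  proof (rule monoidI)
    show "\<one>\<^bsub>?A\<^esub> \<in> carrier ?A"
      by (auto simp: complete_path_algebra_def paths_def pre_digraph.awalk_def
          pre_digraph.cas.simps split: if_splits)
    show "x \<otimes>\<^bsub>?A\<^esub> y \<in> carrier ?A" if "x \<in> carrier ?A" "y \<in> carrier ?A" for x y
      using series_mult_closed[OF that] by (simp add: complete_path_algebra_def)
    show "x \<otimes>\<^bsub>?A\<^esub> y \<otimes>\<^bsub>?A\<^esub> z = x \<otimes>\<^bsub>?A\<^esub> (y \<otimes>\<^bsub>?A\<^esub> z)" for x y z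
      by (simp add: complete_path_algebra_def series_mult_assoc)
    fix x assume x: "x \<in> carrier ?A"
    have "(\<one>\<^bsub>?A\<^esub> \<otimes>\<^bsub>?A\<^esub> x) (u, w) = x (u, w)" for u w
    proof -
      have "(\<one>\<^bsub>?A\<^esub> \<otimes>\<^bsub>?A\<^esub> x) (u, w) =
          (\<Sum>n\<le>length w. if n = 0 then (if u \<in> verts Q then x (u, w) else 0) else 0)"
        by (simp only: complete_path_algebra_def series_mult_def ring.simps monoid.simps prod.case,
            intro sum.cong) (auto simp: *)
      then show ?thesis
        using supp[OF x, of "(u, w)"] by (auto simp: paths_def pre_digraph.awalk_def)
    qed
    then show "\<one>\<^bsub>?A\<^esub> \<otimes>\<^bsub>?A\<^esub> x = x" by auto
    have "(x \<otimes>\<^bsub>?A\<^esub> \<one>\<^bsub>?A\<^esub>) (u, w) = x (u, w)" for u w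
    proof -
      have "(x \<otimes>\<^bsub>?A\<^esub> \<one>\<^bsub>?A\<^esub>) (u, w) =
          (\<Sum>n\<le>length w. if n = length w then
             (if pre_digraph.awlast Q u w \<in> verts Q then x (u, w) else 0) else 0)"
        by (simp only: complete_path_algebra_def series_mult_def ring.simps monoid.simps prod.case,
            intro sum.cong) auto
      moreover have "x (u, w) = 0" if "pre_digraph.awlast Q u w \<notin> verts Q"
      proof (rule ccontr)
        assume "x (u, w) \<noteq> 0"
        then obtain v where v: "pre_digraph.awalk Q u w v"
          using supp[OF x, of "(u, w)"] by (auto simp: paths_def)
        with that assms show False
          by (auto dest: wf_digraph.awlast_in_verts simp: pre_digraph.awalk_def)
      qed
      ultimately show ?thesis by auto
    qed
    then show "x \<otimes>\<^bsub>?A\<^esub> \<one>\<^bsub>?A\<^esub> = x" by auto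
  qed
qed (auto simp: complete_path_algebra_def series_mult_def algebra_simps sum.distrib fun_eq_iff)

text \<open>Isomorphisms of algebras that fix the lazy paths.\<close>

definition path_algebra_iso ::
  "('v, 'a) pre_digraph \<Rightarrow> ('v, 'b) pre_digraph
    \<Rightarrow> (('v, 'a, 'k::field) series \<Rightarrow> ('v, 'b, 'k) series) \<Rightarrow> bool"
where
  "path_algebra_iso Q Q' \<phi> \<longleftrightarrow>
    \<phi> \<in> ring_iso (complete_path_algebra Q) (complete_path_algebra Q') \<and>
    (\<forall>c. \<forall>x\<in>carrier (complete_path_algebra Q). \<phi> (series_scale c x) = series_scale c (\<phi> x)) \<and>
    (\<forall>i\<in>verts Q. \<phi> (lazy i) = lazy i)"

text \<open>
  The closure is that of the topology of the completion: the \<open>n\<close>-th power of the closed arrow ideal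
  consists of the series all of whose terms have length at least \<open>n\<close>.
\<close>

definition adic_closure :: "('v, 'a, 'k::field) series set \<Rightarrow> ('v, 'a, 'k) series set" where
  "adic_closure X = {x. \<forall>n. \<exists>y\<in>X. \<forall>u w. length w < n \<longrightarrow> x (u, w) = y (u, w)}"

definition commutators :: "('v, 'a) pre_digraph \<Rightarrow> ('v, 'a, 'k::field) series set" where
  "commutators Q =
    {series_mult Q x y - series_mult Q y x | x y.
      x \<in> carrier (complete_path_algebra Q) \<and> y \<in> carrier (complete_path_algebra Q)}"

definition cyclically_equivalent ::
  "('v, 'a) pre_digraph \<Rightarrow> ('v, 'a, 'k::field) series \<Rightarrow> ('v, 'a, 'k) series \<Rightarrow> bool"
where
  "cyclically_equivalent Q W W' \<longleftrightarrow> W - W' \<in> adic_closure (series.span (commutators Q))"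


section \<open>Quivers with potential\<close>

type_synonym ('v, 'a, 'k) qp = "('v, 'a) pre_digraph \<times> ('v, 'a, 'k) series"

text \<open>Cycles may repeat vertices and arrows; they are just closed paths.\<close>

definition cycles_of_length_ge :: "('v, 'a) pre_digraph \<Rightarrow> nat \<Rightarrow> ('v, 'a) path set" where
  "cycles_of_length_ge Q n = {(u, w). pre_digraph.awalk Q u w u \<and> n \<le> length w}"

definition potential :: "('v, 'a) pre_digraph \<Rightarrow> ('v, 'a, 'k::field) series \<Rightarrow> bool" where
  "potential Q W \<longleftrightarrow> (\<forall>p. W p \<noteq> 0 \<longrightarrow> p \<in> cycles_of_length_ge Q 2)"

fun is_qp :: "('v, 'a, 'k::field) qp \<Rightarrow> bool" where
  "is_qp (Q, W) \<longleftrightarrow> fin_digraph Q \<and> potential Q W"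

fun reduced_qp :: "('v, 'a, 'k::field) qp \<Rightarrow> bool" where
  "reduced_qp (Q, W) \<longleftrightarrow> is_qp (Q, W) \<and> (\<forall>p. W p \<noteq> 0 \<longrightarrow> p \<in> cycles_of_length_ge Q 3)"

fun right_equivalent :: "('v, 'a, 'k::field) qp \<Rightarrow> ('v, 'b, 'k) qp \<Rightarrow> bool" where
  "right_equivalent (Q, W) (Q', W') \<longleftrightarrow>
    verts Q = verts Q' \<and>
    (\<exists>\<phi>. path_algebra_iso Q Q' \<phi> \<and> cyclically_equivalent Q' (\<phi> W) W')"

text \<open>
  The linear and continuous extension of a map \<open>f\<close> from paths to series. It is only used for \<open>f\<close>
  such that each path occurs in \<open>f p\<close> for only finitely many paths \<open>p\<close>, so that the sum is finite.
\<close>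

definition series_extend :: "('p \<Rightarrow> ('q \<Rightarrow> 'k::field)) \<Rightarrow> ('p \<Rightarrow> 'k) \<Rightarrow> ('q \<Rightarrow> 'k)" where
  "series_extend f x = (\<lambda>q. \<Sum>p | x p \<noteq> 0 \<and> f p q \<noteq> 0. x p * f p q)"

definition map_arrows :: "('a \<Rightarrow> 'b) \<Rightarrow> ('v, 'a, 'k::field) series \<Rightarrow> ('v, 'b, 'k) series" where
  "map_arrows f = series_extend (\<lambda>(u, w). single (u, map f w) 1)"

text \<open>Only used for quivers on the same vertex set.\<close>

fun direct_sum_qp ::
  "('v, 'a, 'k::field) qp \<Rightarrow> ('v, 'b, 'k) qp \<Rightarrow> ('v, 'a + 'b, 'k) qp"
where
  "direct_sum_qp (Q', W') (Q'', W'') =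
    (\<lparr>verts = verts Q', arcs = arcs Q' <+> arcs Q'',
      tail = case_sum (tail Q') (tail Q''), head = case_sum (head Q') (head Q'')\<rparr>,
     map_arrows Inl W' + map_arrows Inr W'')"

definition arrow_span :: "('v, 'a) pre_digraph \<Rightarrow> ('v, 'a, 'k::field) series set" where
  "arrow_span Q = series.span ((\<lambda>a. path_elem Q [a]) ` arcs Q)"

fun trivial_qp :: "('v, 'a, 'k::field) qp \<Rightarrow> bool" where
  "trivial_qp (Q, W) \<longleftrightarrow>
    is_qp (Q, W) \<and> loopfree_digraph Q \<and>
    (\<exists>(n::nat) \<alpha> \<beta> \<phi>.
      inj_on \<alpha> {..<n} \<and> inj_on \<beta> {..<n} \<and> \<alpha> ` {..<n} \<inter> \<beta> ` {..<n} = {} \<and>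
      arcs Q = \<alpha> ` {..<n} \<union> \<beta> ` {..<n} \<and>
      (\<forall>r<n. head Q (\<alpha> r) = tail Q (\<beta> r) \<and> head Q (\<beta> r) = tail Q (\<alpha> r)) \<and>
      path_algebra_iso Q Q \<phi> \<and> \<phi> ` arrow_span Q = (arrow_span Q :: ('v, 'a, 'k) series set) \<and>
      cyclically_equivalent Q W (\<phi> (\<Sum>r<n. path_elem Q [\<alpha> r, \<beta> r])))"

text \<open>
  The arrows of the trivial summand are taken to be natural numbers; as the quiver is finite this is
  only a choice of names for them. By the Splitting Theorem, the reduced part of a quiver with
  potential exists and is unique up to right equivalence. Accordingly the reduced part, and with
  it the mutation, is a relation.
\<close>

definition is_reduced_part :: "('v, 'a, 'k::field) qp \<Rightarrow> ('v, 'b, 'k) qp \<Rightarrow> bool" where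
  "is_reduced_part P R \<longleftrightarrow>
    reduced_qp R \<and>
    (\<exists>T :: ('v, nat, 'k) qp. trivial_qp T \<and> verts (fst T) = verts (fst R) \<and>
      right_equivalent P (direct_sum_qp R T))"


section \<open>Mutation\<close>

text \<open>\<open>Comp \<alpha> \<beta>\<close> is the arrow \<open>[\<alpha>\<beta>]\<close> and \<open>Star \<alpha>\<close> is \<open>\<alpha>\<^sup>*\<close>.\<close>

datatype 'a mut_arrow = Old 'a | Comp 'a 'a | Star 'a

definition no_two_cycles :: "('v, 'a) pre_digraph \<Rightarrow> bool" where
  "no_two_cycles Q \<longleftrightarrow>
    \<not> (\<exists>a\<in>arcs Q. \<exists>b\<in>arcs Q. a \<noteq> b \<and> head Q a = tail Q b \<and> head Q b = tail Q a)"

definition through :: "('v, 'a) pre_digraph \<Rightarrow> 'v \<Rightarrow> ('a \<times> 'a) set" where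
  "through Q k = {(\<alpha>, \<beta>). \<alpha> \<in> arcs Q \<and> \<beta> \<in> arcs Q \<and> head Q \<alpha> = k \<and> tail Q \<beta> = k}"

definition through_from_to :: "('v, 'a) pre_digraph \<Rightarrow> 'v \<Rightarrow> 'v \<Rightarrow> 'v \<Rightarrow> ('a \<times> 'a) set" where
  "through_from_to Q k i j = {(\<alpha>, \<beta>) \<in> through Q k. tail Q \<alpha> = i \<and> head Q \<beta> = j}"

definition arrows_from_to :: "('v, 'a) pre_digraph \<Rightarrow> 'v \<Rightarrow> 'v \<Rightarrow> 'a set" where
  "arrows_from_to Q i j = {a \<in> arcs Q. tail Q a = i \<and> head Q a = j}"

text \<open>Pre-mutation at a vertex \<open>k\<close> without loops.\<close>

definition premutation_quiver ::
  "('v, 'a) pre_digraph \<Rightarrow> 'v \<Rightarrow> ('v, 'a mut_arrow) pre_digraph"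
where
  "premutation_quiver Q k =
    \<lparr>verts = verts Q,
     arcs = Old ` {a \<in> arcs Q. tail Q a \<noteq> k \<and> head Q a \<noteq> k}
       \<union> (\<lambda>(\<alpha>, \<beta>). Comp \<alpha> \<beta>) ` through Q k
       \<union> Star ` {a \<in> arcs Q. tail Q a = k \<or> head Q a = k},
     tail = (\<lambda>x. case x of Old a \<Rightarrow> tail Q a | Comp \<alpha> \<beta> \<Rightarrow> tail Q \<alpha> | Star a \<Rightarrow> head Q a),
     head = (\<lambda>x. case x of Old a \<Rightarrow> head Q a | Comp \<alpha> \<beta> \<Rightarrow> head Q \<beta> | Star a \<Rightarrow> tail Q a)\<rparr>"

definition no_term_starts_at :: "'v \<Rightarrow> ('v, 'a, 'k::field) series \<Rightarrow> bool" where
  "no_term_starts_at k W \<longleftrightarrow> (\<forall>w. W (k, w) = 0)"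

text \<open>
  On a cycle that does not start at \<open>k\<close>, every arrow ending at \<open>k\<close> is followed by one starting
  at \<open>k\<close>, and (in the absence of loops) such pairs do not overlap.
\<close>

fun bracket_word :: "('v, 'a) pre_digraph \<Rightarrow> 'v \<Rightarrow> 'a list \<Rightarrow> 'a mut_arrow list" where
  "bracket_word Q k [] = []"
| "bracket_word Q k [a] = [Old a]"
| "bracket_word Q k (a # b # w) =
    (if head Q a = k then Comp a b # bracket_word Q k w else Old a # bracket_word Q k (b # w))"

definition bracket ::
  "('v, 'a) pre_digraph \<Rightarrow> 'v \<Rightarrow> ('v, 'a, 'k::field) series \<Rightarrow> ('v, 'a mut_arrow, 'k) series"
where
  "bracket Q k = series_extend (\<lambda>(u, w). single (u, bracket_word Q k w) 1)"

fun premutation :: "'v \<Rightarrow> ('v, 'a, 'k::field) qp \<Rightarrow> ('v, 'a mut_arrow, 'k) qp" where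
  "premutation k (Q, W) =
    (premutation_quiver Q k,
     (\<Sum>(\<alpha>, \<beta>)\<in>through Q k. path_elem (premutation_quiver Q k) [Comp \<alpha> \<beta>, Star \<beta>, Star \<alpha>])
       + bracket Q k W)"

text \<open>
  If there are no loops at \<open>k\<close>, every potential is cyclically equivalent to one without terms
  starting at \<open>k\<close>; this is required here of the given one.
\<close>

definition is_mutation :: "'v \<Rightarrow> ('v, 'a, 'k::field) qp \<Rightarrow> ('v, 'b, 'k) qp \<Rightarrow> bool" where
  "is_mutation k P R \<longleftrightarrow>
    is_qp P \<and> no_term_starts_at k (snd P) \<and> is_reduced_part (premutation k P) R"


section \<open>Matchings\<close>

text \<open>
  The sets \<open>through_from_to Q k i j\<close> for different \<open>(i, j)\<close> are disjoint, so the bijections for all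
  \<open>i, j\<close> are given by a single map \<open>m\<close>.
\<close>

definition matching ::
  "('v, 'a) pre_digraph \<Rightarrow> 'v \<Rightarrow> ('v \<Rightarrow> 'v \<Rightarrow> ('a \<times> 'a) set) \<Rightarrow> ('v \<Rightarrow> 'v \<Rightarrow> 'a set)
    \<Rightarrow> ('a \<times> 'a \<Rightarrow> 'a) \<Rightarrow> bool"
where
  "matching Q k C' \<Gamma>' m \<longleftrightarrow>
    (\<forall>i\<in>verts Q - {k}. \<forall>j\<in>verts Q - {k}.
      C' i j \<subseteq> through_from_to Q k i j \<and> \<Gamma>' i j \<subseteq> arrows_from_to Q j i \<and>
      bij_betw m (C' i j) (\<Gamma>' i j))"

definition maximal_matching ::
  "('v, 'a) pre_digraph \<Rightarrow> 'v \<Rightarrow> ('v \<Rightarrow> 'v \<Rightarrow> ('a \<times> 'a) set) \<Rightarrow> ('v \<Rightarrow> 'v \<Rightarrow> 'a set)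
    \<Rightarrow> ('a \<times> 'a \<Rightarrow> 'a) \<Rightarrow> bool"
where
  "maximal_matching Q k C' \<Gamma>' m \<longleftrightarrow>
    matching Q k C' \<Gamma>' m \<and>
    (\<forall>i\<in>verts Q - {k}. \<forall>j\<in>verts Q - {k}.
      card (C' i j) = min (card (through_from_to Q k i j)) (card (arrows_from_to Q j i)) \<and>
      card (\<Gamma>' i j) = min (card (through_from_to Q k i j)) (card (arrows_from_to Q j i)))"

definition matched :: "('v, 'a) pre_digraph \<Rightarrow> 'v \<Rightarrow> ('v \<Rightarrow> 'v \<Rightarrow> 'b set) \<Rightarrow> 'b set" where
  "matched Q k X = (\<Union>i\<in>verts Q - {k}. \<Union>j\<in>verts Q - {k}. X i j)"

text \<open>In the rest, \<open>P\<close> and \<open>G\<close> are the unions of the families \<open>C'\<close> and \<open>\<Gamma>'\<close> of a matching.\<close>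

definition partner_in :: "('a \<times> 'a) set \<Rightarrow> ('a \<times> 'a \<Rightarrow> 'a) \<Rightarrow> 'a \<Rightarrow> 'a" where
  "partner_in P m \<gamma> = fst (inv_into P m \<gamma>)"

definition partner_out :: "('a \<times> 'a) set \<Rightarrow> ('a \<times> 'a \<Rightarrow> 'a) \<Rightarrow> 'a \<Rightarrow> 'a" where
  "partner_out P m \<gamma> = snd (inv_into P m \<gamma>)"

definition mutation_quiver ::
  "('v, 'a) pre_digraph \<Rightarrow> 'v \<Rightarrow> ('a \<times> 'a) set \<Rightarrow> 'a set \<Rightarrow> ('v, 'a mut_arrow) pre_digraph"
where
  "mutation_quiver Q k P G =
    (premutation_quiver Q k)
      \<lparr>arcs := arcs (premutation_quiver Q k) - Old ` G - (\<lambda>(\<alpha>, \<beta>). Comp \<alpha> \<beta>) ` P\<rparr>"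

text \<open>
  The replacement defining \<open>S\<^sup>*\<close>, for \<open>S\<close> without terms starting at \<open>k\<close> and in which no path
  \<open>\<alpha>\<beta>\<close> with \<open>(\<alpha>, \<beta>) \<in> P\<close> appears. Each replaced arrow of \<open>G\<close> contributes a sign \<open>-1\<close>.
\<close>

definition star_word ::
  "('v, 'a) pre_digraph \<Rightarrow> 'v \<Rightarrow> ('a \<times> 'a) set \<Rightarrow> 'a set \<Rightarrow> ('a \<times> 'a \<Rightarrow> 'a)
    \<Rightarrow> 'a list \<Rightarrow> 'a mut_arrow list"
where
  "star_word Q k P G m w =
    concat (map
      (\<lambda>x. case x of
          Old a \<Rightarrow> if a \<in> G then [Star (partner_out P m a), Star (partner_in P m a)] else [Old a]
        | _ \<Rightarrow> [x])
      (bracket_word Q k w))"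

definition star_potential ::
  "('v, 'a) pre_digraph \<Rightarrow> 'v \<Rightarrow> ('a \<times> 'a) set \<Rightarrow> 'a set \<Rightarrow> ('a \<times> 'a \<Rightarrow> 'a)
    \<Rightarrow> ('v, 'a, 'k::field) series \<Rightarrow> ('v, 'a mut_arrow, 'k) series"
where
  "star_potential Q k P G m =
    series_extend
      (\<lambda>(u, w). single (u, star_word Q k P G m w) ((-1) ^ length (filter (\<lambda>a. a \<in> G) w)))"

end

theory Submission
  imports Defs
begin

text \<open>
  A matched pair contributes \<open>[\<alpha>\<^sub>\<gamma>\<beta>\<^sub>\<gamma>] (\<gamma> + \<beta>\<^sub>\<gamma>\<^sup>* \<alpha>\<^sub>\<gamma>\<^sup>*)\<close> to the potential of the pre-mutation. The automorphism
  \<open>\<gamma> \<mapsto> \<gamma> - \<beta>\<^sub>\<gamma>\<^sup>* \<alpha>\<^sub>\<gamma>\<^sup>*\<close> turns this into the 2-cycle \<open>[\<alpha>\<^sub>\<gamma>\<beta>\<^sub>\<gamma>] \<gamma>\<close>, and turns \<open>[S]\<close> into \<open>S\<^sup>*\<close> plus terms that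
  involve some \<open>\<gamma> \<in> \<Gamma>'\<close>. Rotating each of these so that it ends in such a \<open>\<gamma>\<close> makes their sum
  cyclically equivalent to \<open>\<Sum> c\<^sub>\<gamma> \<gamma>\<close>, where no \<open>c\<^sub>\<gamma>\<close> involves an arrow \<open>[\<alpha>\<beta>]\<close> of a matched pair. So the
  automorphism \<open>[\<alpha>\<^sub>\<gamma>\<beta>\<^sub>\<gamma>] \<mapsto> [\<alpha>\<^sub>\<gamma>\<beta>\<^sub>\<gamma>] - c\<^sub>\<gamma>\<close> absorbs them into the 2-cycles, which then split off.
  Maximality of the matching is what makes the remaining potential reduced.
\<close>

section \<open>Continuous homomorphisms of complete path algebras\<close>

text \<open>In general, 2-cycles are split off by an infinite composition of automorphisms. Here two
  suffice: the paths \<open>\<alpha>\<beta>\<close> of matched pairs do not occur in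
  \<open>S\<close>, so their composite arrows do not occur in [S], and the first automorphism brings
  none in. The second one therefore changes neither the shifted [S] nor its own correction terms,
  and nothing is left to repair. Invertibility needs the same observation. If \<open>S\<close>
  contains a cycle \<alpha>\<beta>\<gamma> with an unmatched pair (\<alpha>, \<beta>), the arrow
  [\<alpha>\<beta>] is a term of the correction belonging to \<gamma>, so the second automorphism
  need not be the identity modulo longer paths. But each of the two adds to some arrows only terms
  in arrows that it fixes, so its inverse is obtained by reversing the signs. The replaced potential
  is not found by expanding products. It is what remains of the shifted [S] when the arrows of
  \<open>G\<close> are set to zero; this projection is multiplicative, so it can be applied to the
  image of each arrow beforehand.\<close>

abbreviation "path_end \<equiv> pre_digraph.awlast"

lemma path_end_Nil [simp]: "path_end Q u [] = u"
  by (simp add: pre_digraph.awalk_verts.simps)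

lemma path_end_Cons [simp]: "path_end Q u (a # w) = path_end Q (head Q a) w"
  by (simp add: pre_digraph.awalk_verts.simps pre_digraph.awalk_verts_non_Nil)

lemma path_end_eq: "pre_digraph.awalk Q u w v \<Longrightarrow> path_end Q u w = v"
  by (auto simp: pre_digraph.awalk_def awlast_eq_if_cas)

lemma paths_iff: "(u, w) \<in> paths Q \<longleftrightarrow> pre_digraph.awalk Q u w (path_end Q u w)"
  unfolding paths_def using path_end_eq by fastforce

lemma carrier_iff: "x \<in> carrier (complete_path_algebra Q) \<longleftrightarrow> (\<forall>p. x p \<noteq> 0 \<longrightarrow> p \<in> paths Q)"
  by (simp add: complete_path_algebra_def)

lemma complete_path_algebra_simps:
  "monoid.mult (complete_path_algebra Q) = series_mult Q"
  "ring.zero (complete_path_algebra Q) = 0"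
  "add (complete_path_algebra Q) = (+)"
  "one (complete_path_algebra Q) = (\<lambda>(u, w). if u \<in> verts Q \<and> w = [] then 1 else 0)"
  by (simp_all add: complete_path_algebra_def)

lemma sum_fun_apply: "(\<Sum>i\<in>A. f i) p = (\<Sum>i\<in>A. f i p)"
  for f :: "'i \<Rightarrow> 'p \<Rightarrow> 'k::field"
  by (induction A rule: infinite_finite_induct) auto

lemma series_scale_apply [simp]: "series_scale c x p = c * x p"
  by (simp add: series_scale_def)

lemma single_apply: "single p c q = (if q = p then c else 0)"
  by (simp add: single_def)

lemma series_mult_apply:
  "series_mult Q x y (u, w) = (\<Sum>n\<le>length w. x (u, take n w) * y (path_end Q u (take n w), drop n w))"
  by (simp add: series_mult_def)

lemma series_mult_nonzeroE:
  assumes "series_mult Q x y (u, w) \<noteq> 0"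
  obtains w1 w2 where "w = w1 @ w2" "x (u, w1) \<noteq> 0" "y (path_end Q u w1, w2) \<noteq> 0"
proof -
  from assms obtain n where "x (u, take n w) * y (path_end Q u (take n w), drop n w) \<noteq> 0"
    unfolding series_mult_apply by (meson sum.neutral)
  with that[of "take n w" "drop n w"] show ?thesis by auto
qed

lemma series_mult_add_right: "series_mult Q x (y + z) = series_mult Q x y + series_mult Q x z"
  by (auto simp: series_mult_apply fun_eq_iff algebra_simps sum.distrib)

lemma series_mult_diff_left: "series_mult Q (x - y) z = series_mult Q x z - series_mult Q y z"
  by (auto simp: series_mult_apply fun_eq_iff algebra_simps sum_subtractf)

lemma series_mult_zero [simp]: "series_mult Q 0 x = 0" "series_mult Q x 0 = 0"
  by (auto simp: series_mult_apply fun_eq_iff)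

lemma series_mult_single_left:
  "series_mult Q (single (u, w) c) y (s, v) =
    (if s = u \<and> prefix w v then c * y (path_end Q u w, drop (length w) v) else 0)"
proof (cases "s = u \<and> prefix w v")
  case True
  then have w: "take (length w) v = w" "length w \<le> length v"
    by (auto elim: prefixE)
  have "single (u, w) c (s, take n v) * y (path_end Q s (take n v), drop n v) =
      (if n = length w then c * y (path_end Q u w, drop (length w) v) else 0)" if "n \<le> length v" for n
  proof (cases "n = length w")
    case True
    then show ?thesis using \<open>s = u \<and> _\<close> w(1) by (simp add: single_apply)
  next
    case False
    then have "take n v \<noteq> w" using that by auto
    then show ?thesis using False by (simp add: single_apply)
  qed
  then show ?thesis using True w(2) by (simp add: series_mult_apply)
next
  case False
  have "series_mult Q (single (u, w) c) y (s, v) = 0"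
  proof (rule ccontr)
    assume "series_mult Q (single (u, w) c) y (s, v) \<noteq> 0"
    then obtain w1 w2 where "v = w1 @ w2" "single (u, w) c (s, w1) \<noteq> 0"
      by (rule series_mult_nonzeroE)
    with False show False by (auto simp: single_apply split: if_splits)
  qed
  with False show ?thesis by auto
qed

lemma series_mult_single_single:
  "series_mult Q (single (u, w) c) (single (u', w') d) =
    (if path_end Q u w = u' then single (u, w @ w') (c * d) else 0)"
proof (rule ext, clarify)
  fix s v
  show "series_mult Q (single (u, w) c) (single (u', w') d) (s, v) =
    (if path_end Q u w = u' then single (u, w @ w') (c * d) else 0) (s, v)"
    unfolding series_mult_single_left by (auto simp: single_apply elim!: prefixE)
qed

lemma series_mult_lazy_left: "series_mult Q (lazy u) y (s, v) = (if s = u then y (s, v) else 0)"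
  by (simp add: lazy_def series_mult_single_left)

text \<open>The admissible images of an arrow from \<open>u\<close> to \<open>v\<close>. The clause
  \<open>w \<noteq> []\<close> excludes lazy paths, which the endpoints alone would allow for
  \<open>u = v\<close>.\<close>

definition parallel_series :: "('v, 'a) pre_digraph \<Rightarrow> 'v \<Rightarrow> 'v \<Rightarrow> ('v, 'a, 'k::field) series \<Rightarrow> bool" where
  "parallel_series Q u v x \<longleftrightarrow> (\<forall>s w. x (s, w) \<noteq> 0 \<longrightarrow> s = u \<and> w \<noteq> [] \<and> pre_digraph.awalk Q u w v)"

lemma parallel_seriesD:
  assumes "parallel_series Q u v x" "x (s, w) \<noteq> 0"
  shows "s = u" "w \<noteq> []" "pre_digraph.awalk Q u w v"
  using assms by (auto simp: parallel_series_def)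

definition words :: "('v, 'a) pre_digraph \<Rightarrow> nat \<Rightarrow> 'a list set" where
  "words Q n = {w. set w \<subseteq> arcs Q \<and> length w \<le> n}"

text \<open>
  The value \<open>0\<close> on lists of arrows that are not paths makes \<open>subst\<close> linear on all series, not only
  on the carrier. Since arrows are sent to series without constant term, a path of length \<open>n\<close> only
  contributes to coefficients of paths of length at least \<open>n\<close>, which justifies the finite sum.
\<close>

primrec subst_path :: "('v, 'a) pre_digraph \<Rightarrow> ('v, 'b) pre_digraph \<Rightarrow> ('a \<Rightarrow> ('v, 'b, 'k::field) series)
    \<Rightarrow> 'a list \<Rightarrow> 'v \<Rightarrow> ('v, 'b, 'k) series" where
  "subst_path Q Q' f [] = (\<lambda>u. if u \<in> verts Q then lazy u else 0)"
| "subst_path Q Q' f (a # w) = (\<lambda>u. if a \<in> arcs Q \<and> tail Q a = u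
    then series_mult Q' (f a) (subst_path Q Q' f w (head Q a)) else 0)"

definition subst :: "('v, 'a) pre_digraph \<Rightarrow> ('v, 'b) pre_digraph \<Rightarrow> ('a \<Rightarrow> ('v, 'b, 'k::field) series)
    \<Rightarrow> ('v, 'a, 'k) series \<Rightarrow> ('v, 'b, 'k) series" where
  "subst Q Q' f x = (\<lambda>(u, v). \<Sum>w\<in>words Q (length v). x (u, w) * subst_path Q Q' f w u (u, v))"

lemma subst_apply: "subst Q Q' f x (u, v) = (\<Sum>w\<in>words Q (length v). x (u, w) * subst_path Q Q' f w u (u, v))"
  by (simp add: subst_def)

lemma subst_add: "subst Q Q' f (x + y) = subst Q Q' f x + subst Q Q' f y"
  by (auto simp: subst_apply fun_eq_iff algebra_simps sum.distrib)

lemma subst_diff: "subst Q Q' f (x - y) = subst Q Q' f x - subst Q Q' f y"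
  by (auto simp: subst_apply fun_eq_iff algebra_simps sum_subtractf)

lemma subst_zero [simp]: "subst Q Q' f 0 = 0"
  by (auto simp: subst_apply fun_eq_iff)

lemma subst_scale: "subst Q Q' f (series_scale c x) = series_scale c (subst Q Q' f x)"
  by (auto simp: subst_apply fun_eq_iff sum_distrib_left mult.assoc)

lemma subst_sum: "subst Q Q' f (\<Sum>i\<in>A. x i) = (\<Sum>i\<in>A. subst Q Q' f (x i))"
  by (induction A rule: infinite_finite_induct) (simp_all only: sum.infinite sum.empty sum.insert subst_zero subst_add simp_thms)

text \<open>Continuity in the adic topology, without loss in the length bound; it carries cyclic
  equivalence through substitutions.\<close>

lemma subst_cong_low:
  assumes "\<And>u w. length w < n \<Longrightarrow> x (u, w) = y (u, w)" "length v < n"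
  shows "subst Q Q' f x (u, v) = subst Q Q' f y (u, v)"
  unfolding subst_apply using assms by (intro sum.cong) (auto simp: words_def)

lemma subst_path_cong:
  assumes "\<And>a. a \<in> set w \<Longrightarrow> f a = g a"
  shows "subst_path Q Q' f w u = subst_path Q Q' g w u"
  using assms by (induction w arbitrary: u) auto

lemma subst_cong:
  assumes "\<And>u w a. x (u, w) \<noteq> 0 \<Longrightarrow> a \<in> set w \<Longrightarrow> f a = g a"
  shows "subst Q Q' f x = subst Q Q' g x"
proof (rule ext, clarify)
  fix u v
  show "subst Q Q' f x (u, v) = subst Q Q' g x (u, v)"
    unfolding subst_apply
  proof (rule sum.cong[OF refl])
    fix w
    show "x (u, w) * subst_path Q Q' f w u (u, v) = x (u, w) * subst_path Q Q' g w u (u, v)"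
      using assms[of u w] subst_path_cong[of w f g Q Q' u] by (cases "x (u, w) = 0") auto
  qed
qed

lemma (in fin_digraph) one_eq_sum_lazy:
  "one (complete_path_algebra G) = (\<Sum>i\<in>verts G. lazy i :: ('a, 'b, 'k::field) series)"
proof (rule ext, clarify)
  fix u and w :: "'b list"
  have "(\<Sum>i\<in>verts G. lazy i (u, w)) =
      (\<Sum>i\<in>verts G. if i = u then if w = [] then 1 else 0 else (0 :: 'k))"
    by (rule sum.cong) (auto simp: lazy_def single_apply)
  then show "one (complete_path_algebra G) (u, w) = (\<Sum>i\<in>verts G. lazy i :: ('a, 'b, 'k) series) (u, w)"
    by (simp add: sum_fun_apply complete_path_algebra_simps)
qed

locale substitution = Q: fin_digraph Q + Q': fin_digraph Q'
  for Q :: "('v, 'a) pre_digraph" and Q' :: "('v, 'b) pre_digraph" +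
  fixes f :: "'a \<Rightarrow> ('v, 'b, 'k::field) series"
  assumes verts_eq: "verts Q' = verts Q"
    and arrow_image: "a \<in> arcs Q \<Longrightarrow> parallel_series Q' (tail Q a) (head Q a) (f a)"
begin

lemma finite_words [simp]: "finite (words Q n)"
  unfolding words_def by (rule finite_lists_length_le) simp

text \<open>Every arrow contributes a nonempty word, hence the bound on lengths; it is replaced by
  parallel paths, hence the endpoints.\<close>

lemma subst_path_nonzero:
  assumes "subst_path Q Q' f w u (s, v) \<noteq> 0"
  shows "s = u" "length w \<le> length v" "Q.awalk u w (Q.awlast u w)" "Q'.awalk u v (Q.awlast u w)"
proof -
  have "s = u \<and> length w \<le> length v \<and> Q.awalk u w (Q.awlast u w) \<and> Q'.awalk u v (Q.awlast u w)"
    using assms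
  proof (induction w arbitrary: u s v)
    case Nil
    then show ?case
      by (auto simp: lazy_def single_apply Q.awalk_Nil_iff Q'.awalk_Nil_iff verts_eq split: if_splits)
  next
    case (Cons a w)
    from Cons.prems have a: "a \<in> arcs Q" "tail Q a = u"
      and "series_mult Q' (f a) (subst_path Q Q' f w (head Q a)) (s, v) \<noteq> 0"
      by (auto split: if_splits)
    from this(3) obtain v1 v2 where v: "v = v1 @ v2" "f a (s, v1) \<noteq> 0"
        "subst_path Q Q' f w (head Q a) (Q'.awlast s v1, v2) \<noteq> 0"
      by (rule series_mult_nonzeroE)
    note f = parallel_seriesD[OF arrow_image[OF a(1)] v(2)]
    have "length v1 \<ge> 1" using f(2) by (cases v1) auto
    then show ?case using Cons.IH[OF v(3)] f a v(1)
      by (auto simp: Q.awalk_Cons_iff intro: Q'.awalk_appendI)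
  qed
  then show "s = u" "length w \<le> length v" "Q.awalk u w (Q.awlast u w)" "Q'.awalk u v (Q.awlast u w)"
    by auto
qed

lemma subst_path_other_start: "s \<noteq> u \<Longrightarrow> subst_path Q Q' f w u (s, v) = 0"
  using subst_path_nonzero(1) by blast

lemma subst_path_append:
  "subst_path Q Q' f (w1 @ w2) u =
    series_mult Q' (subst_path Q Q' f w1 u) (subst_path Q Q' f w2 (Q.awlast u w1))"
proof (induction w1 arbitrary: u)
  case Nil
  \<comment> \<open>For \<open>u\<close> outside \<open>verts Q\<close> the empty word has value
    \<open>0\<close>; this is consistent because no path starts there.\<close>
  show ?case
  proof (cases "u \<in> verts Q")
    case True
    then show ?thesis
      by (auto simp: fun_eq_iff series_mult_lazy_left subst_path_other_start)
  next
    case False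
    then have "subst_path Q Q' f w2 u p = 0" for p
      using subst_path_nonzero(3)[of w2 u "fst p" "snd p"] by (auto dest: Q.awalk_hd_in_verts)
    then have "subst_path Q Q' f w2 u = 0" by (simp add: fun_eq_iff)
    then show ?thesis using False by (simp only: append_Nil subst_path.simps if_False series_mult_zero path_end_Nil)
  qed
next
  case (Cons a w1)
  then show ?case by (simp add: series_mult_assoc)
qed

text \<open>With a common bound, the coefficients at all pieces of one path become sums over the
  same index set, and finite sums can be exchanged.\<close>

lemma subst_apply_words:
  assumes "length v \<le> n"
  shows "subst Q Q' f x (u, v) = (\<Sum>w\<in>words Q n. x (u, w) * subst_path Q Q' f w u (u, v))"
  unfolding subst_apply
proof (rule sum.mono_neutral_left)
  show "\<forall>w\<in>words Q n - words Q (length v). x (u, w) * subst_path Q Q' f w u (u, v) = 0"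
    using subst_path_nonzero(2)[of _ u u v] by (auto simp: words_def)
  show "finite (words Q n)" by (rule finite_words)
  show "words Q (length v) \<subseteq> words Q n" using assms by (auto simp: words_def)
qed

lemma subst_single: "subst Q Q' f (single (u, w) c) = series_scale c (subst_path Q Q' f w u)"
proof (rule ext, clarify)
  fix s v
  have "subst Q Q' f (single (u, w) c) (s, v) =
      (\<Sum>w'\<in>words Q (length v). if w' = w then single (u, w) c (s, w) * subst_path Q Q' f w s (s, v) else 0)"
    unfolding subst_apply by (rule sum.cong) (auto simp: single_apply)
  also have "\<dots> = (if w \<in> words Q (length v) then single (u, w) c (s, w) * subst_path Q Q' f w s (s, v) else 0)"
    by simp
  also have "\<dots> = c * subst_path Q Q' f w u (s, v)"
  proof (cases "subst_path Q Q' f w u (s, v) = 0")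
    case False
    from subst_path_nonzero[OF this] show ?thesis by (auto simp: single_apply words_def)
  next
    case True
    then show ?thesis by (auto simp: single_apply)
  qed
  finally show "subst Q Q' f (single (u, w) c) (s, v) = series_scale c (subst_path Q Q' f w u) (s, v)"
    by simp
qed

lemma subst_lazy: "i \<in> verts Q \<Longrightarrow> subst Q Q' f (lazy i) = lazy i"
  by (simp only: lazy_def[of i, where 'a = 'a] subst_single subst_path.simps if_True series.scale_one)

lemma subst_arrow:
  assumes "a \<in> arcs Q"
  shows "subst Q Q' f (path_elem Q [a]) = f a"
proof -
  have "series_mult Q' (f a) (lazy (head Q a)) = f a"
  proof (rule ext, clarify)
    fix s v
    have "f a (s, take n v) * lazy (head Q a) (Q'.awlast s (take n v), drop n v) =
        (if n = length v then f a (s, v) else 0)" if "n \<le> length v" for n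
      using that parallel_seriesD[OF arrow_image[OF assms], of s v]
      by (cases "f a (s, v) = 0") (auto simp: lazy_def single_apply path_end_eq)
    then show "series_mult Q' (f a) (lazy (head Q a)) (s, v) = f a (s, v)"
      by (simp add: series_mult_apply)
  qed
  then show ?thesis using assms by (simp add: path_elem_def subst_single fun_eq_iff)
qed

lemma subst_closed: "subst Q Q' f x \<in> carrier (complete_path_algebra Q')"
  unfolding carrier_iff
proof (clarify)
  fix u v assume "subst Q Q' f x (u, v) \<noteq> 0"
  then obtain w where "x (u, w) * subst_path Q Q' f w u (u, v) \<noteq> 0"
    unfolding subst_apply by (meson sum.neutral)
  then show "(u, v) \<in> paths Q'" using subst_path_nonzero(4)[of w u u v] by (auto simp: paths_def)
qed

text \<open>Both sides are sums of \<open>T m w1 w2\<close> over a cut \<open>m\<close> of the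
  target path and two source words. On the left the words arise by cutting one word, so their
  lengths add up to at most \<open>?N\<close>; on the right each is bounded by \<open>?N\<close>
  separately. The additional terms vanish by \<open>T_length\<close>.\<close>

lemma subst_mult: "subst Q Q' f (series_mult Q x y) = series_mult Q' (subst Q Q' f x) (subst Q Q' f y)"
proof (rule ext, clarify)
  fix u and v :: "'b list"
  let ?N = "length v"
  let ?l = "Q.awlast u" and ?l' = "Q'.awlast u"
  let ?s = "\<lambda>w u v. subst_path Q Q' f w u (u, v)"
  define T where "T m w1 w2 = x (u, w1) * ?s w1 u (take m v) * (y (?l w1, w2) *
      subst_path Q Q' f w2 (?l w1) (?l' (take m v), drop m v))" for m w1 w2
  have T_length: "length w1 \<le> m \<and> length w2 \<le> ?N - m \<and> ?l' (take m v) = ?l w1"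
    if "T m w1 w2 \<noteq> 0" "m \<le> ?N" for m w1 w2
    using that subst_path_nonzero[of w1 u u "take m v"]
      subst_path_nonzero[of w2 "?l w1" "?l' (take m v)" "drop m v"] unfolding T_def by auto
  let ?A = "SIGMA w:words Q ?N. {..length w}"
  let ?B = "{(w1, w2). set w1 \<subseteq> arcs Q \<and> set w2 \<subseteq> arcs Q \<and> length w1 + length w2 \<le> ?N}"
  have B: "?B \<subseteq> words Q ?N \<times> words Q ?N" by (auto simp: words_def)
  have "subst Q Q' f (series_mult Q x y) (u, v) = (\<Sum>w\<in>words Q ?N. \<Sum>n\<le>length w. \<Sum>m\<le>?N. T m (take n w) (drop n w))"
    unfolding subst_apply series_mult_apply
  proof (rule sum.cong[OF refl])
    fix w
    have "x (u, take n w) * y (?l (take n w), drop n w) * ?s w u v = (\<Sum>m\<le>?N. T m (take n w) (drop n w))" for n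
    proof -
      have "?s w u v = series_mult Q' (subst_path Q Q' f (take n w) u)
          (subst_path Q Q' f (drop n w) (?l (take n w))) (u, v)"
        by (metis append_take_drop_id subst_path_append)
      then show ?thesis by (simp add: series_mult_apply T_def sum_distrib_left mult_ac)
    qed
    then show "(\<Sum>n\<le>length w. x (u, take n w) * y (?l (take n w), drop n w)) * ?s w u v =
        (\<Sum>n\<le>length w. \<Sum>m\<le>?N. T m (take n w) (drop n w))"
      by (simp add: sum_distrib_right)
  qed
  also have "\<dots> = (\<Sum>(w, n)\<in>?A. \<Sum>m\<le>?N. T m (take n w) (drop n w))"
    by (rule sum.Sigma) auto
  also have "\<dots> = (\<Sum>(w1, w2)\<in>?B. \<Sum>m\<le>?N. T m w1 w2)"
    by (rule sum.reindex_bij_witness[where i = "\<lambda>(w1, w2). (w1 @ w2, length w1)"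
          and j = "\<lambda>(w, n). (take n w, drop n w)"])
      (auto simp: words_def dest: in_set_takeD in_set_dropD)
  also have "\<dots> = (\<Sum>(w1, w2)\<in>words Q ?N \<times> words Q ?N. \<Sum>m\<le>?N. T m w1 w2)"
  proof (rule sum.mono_neutral_left[OF _ B])
    show "\<forall>p\<in>words Q ?N \<times> words Q ?N - ?B. (case p of (w1, w2) \<Rightarrow> \<Sum>m\<le>?N. T m w1 w2) = 0"
      by (auto simp: words_def intro!: sum.neutral) (use T_length in fastforce)
  qed simp
  also have "\<dots> = (\<Sum>w1\<in>words Q ?N. \<Sum>w2\<in>words Q ?N. \<Sum>m\<le>?N. T m w1 w2)"
    by (rule sum.Sigma[symmetric]) auto
  also have "\<dots> = (\<Sum>m\<le>?N. \<Sum>w1\<in>words Q ?N. \<Sum>w2\<in>words Q ?N. T m w1 w2)"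
    by (simp add: sum.swap[of _ "{..?N}"])
  also have "\<dots> = series_mult Q' (subst Q Q' f x) (subst Q Q' f y) (u, v)"
    unfolding series_mult_apply
  proof (rule sum.cong[OF refl])
    fix m assume "m \<in> {..?N}"
    then have m: "m \<le> ?N" by simp
    have "T m w1 w2 = (x (u, w1) * ?s w1 u (take m v)) *
        (y (?l' (take m v), w2) * ?s w2 (?l' (take m v)) (drop m v))" for w1 w2
    proof (cases "?s w1 u (take m v) = 0")
      case False
      from path_end_eq[OF subst_path_nonzero(4)[OF False]] show ?thesis by (simp add: T_def)
    qed (simp add: T_def)
    then show "(\<Sum>w1\<in>words Q ?N. \<Sum>w2\<in>words Q ?N. T m w1 w2) =
        subst Q Q' f x (u, take m v) * subst Q Q' f y (?l' (take m v), drop m v)"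
      using m by (simp add: subst_apply_words[where n = ?N] sum_product)
  qed
  finally show "subst Q Q' f (series_mult Q x y) (u, v) =
      series_mult Q' (subst Q Q' f x) (subst Q Q' f y) (u, v)" .
qed

lemma subst_one:
  "subst Q Q' f (one (complete_path_algebra Q)) = one (complete_path_algebra Q')"
  by (simp add: Q.one_eq_sum_lazy Q'.one_eq_sum_lazy subst_sum verts_eq subst_lazy cong: sum.cong)

lemma subst_ring_hom: "subst Q Q' f \<in> ring_hom (complete_path_algebra Q) (complete_path_algebra Q')"
  by (rule ring_hom_memI)
    (simp_all add: complete_path_algebra_simps(1-3) subst_closed subst_mult subst_add subst_one)

end

section \<open>Composition and inverses of substitutions\<close>

lemma subst_subst_path:
  assumes "substitution Q Q' f" "substitution Q' Q'' g"
  shows "subst Q' Q'' g (subst_path Q Q' f w u) = subst_path Q Q'' (\<lambda>a. subst Q' Q'' g (f a)) w u"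
proof -
  interpret f: substitution Q Q' f by fact
  interpret g: substitution Q' Q'' g by fact
  show ?thesis
    by (induction w arbitrary: u) (simp_all add: g.subst_lazy f.verts_eq g.subst_mult)
qed

lemma subst_subst:
  fixes Q'' :: "('v, 'c) pre_digraph"
  assumes "substitution Q Q' f" "substitution Q' Q'' g"
  shows "subst Q' Q'' g (subst Q Q' f x) = subst Q Q'' (\<lambda>a. subst Q' Q'' g (f a)) x"
proof (rule ext, clarify)
  interpret f: substitution Q Q' f by fact
  interpret g: substitution Q' Q'' g by fact
  fix u and v :: "'c list"
  let ?n = "length v"
  \<comment> \<open>The coefficients at all \<open>w'\<close> are expanded with the bound
    \<open>?n\<close> instead of \<open>length w'\<close>, so that the two sums can be
    swapped.\<close>
  have "subst Q' Q'' g (subst Q Q' f x) (u, v) = (\<Sum>w'\<in>words Q' ?n. \<Sum>w\<in>words Q ?n.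
      x (u, w) * (subst_path Q Q' f w u (u, w') * subst_path Q' Q'' g w' u (u, v)))"
    unfolding subst_apply[of Q' Q'']
    by (rule sum.cong[OF refl], subst f.subst_apply_words[where n = ?n])
      (auto simp: words_def sum_distrib_right mult.assoc)
  also have "\<dots> = (\<Sum>w\<in>words Q ?n. x (u, w) * subst Q' Q'' g (subst_path Q Q' f w u) (u, v))"
    by (subst sum.swap) (simp add: subst_apply sum_distrib_left)
  finally show "subst Q' Q'' g (subst Q Q' f x) (u, v) = subst Q Q'' (\<lambda>a. subst Q' Q'' g (f a)) x (u, v)"
    by (simp add: subst_subst_path[OF assms] subst_apply)
qed

lemma (in fin_digraph) substitution_id: "substitution G G (\<lambda>a. path_elem G [a])"
  by unfold_locales
    (auto simp: parallel_series_def path_elem_def single_apply awalk_simps split: if_splits)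

lemma (in fin_digraph) subst_path_id:
  assumes "(u, w) \<in> paths G"
  shows "subst_path G G (\<lambda>a. path_elem G [a]) w u = single (u, w) 1"
  using assms
  by (induction w arbitrary: u)
    (auto simp: paths_iff awalk_simps lazy_def path_elem_def series_mult_single_single)

lemma (in fin_digraph) subst_id:
  fixes x :: "('a, 'b, 'c::field) series"
  assumes "x \<in> carrier (complete_path_algebra G)"
  shows "subst G G (\<lambda>a. path_elem G [a]) x = x"
proof (rule ext, clarify)
  fix u v
  interpret substitution G G "\<lambda>a. path_elem G [a] :: ('a, 'b, 'c) series" by (rule substitution_id)
  have "x (u, w) * subst_path G G (\<lambda>a. path_elem G [a]) w u (u, v) = (if w = v then x (u, v) else 0)" for w
  proof (cases "x (u, w) = 0")
    case False
    then have "subst_path G G (\<lambda>a. path_elem G [a]) w u = (single (u, w) 1 :: ('a, 'b, 'c) series)"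
      using assms by (intro subst_path_id) (auto simp: carrier_iff)
    then show ?thesis by (simp add: single_apply)
  qed auto
  moreover have "x (u, v) = 0" if "v \<notin> words G (length v)"
    using that assms by (auto simp: carrier_iff words_def paths_def awalk_def)
  ultimately show "subst G G (\<lambda>a. path_elem G [a]) x (u, v) = x (u, v)"
    by (auto simp: subst_apply)
qed

text \<open>Composites of substitutions are substitutions, and one that fixes every arrow is the
  identity on the carrier; so being mutually inverse need only be tested on arrows.\<close>

lemma path_algebra_iso_subst:
  assumes f: "substitution Q Q' f" and g: "substitution Q' Q g"
    and gf: "\<And>a. a \<in> arcs Q \<Longrightarrow> subst Q' Q g (f a) = path_elem Q [a]"
    and fg: "\<And>a. a \<in> arcs Q' \<Longrightarrow> subst Q Q' f (g a) = path_elem Q' [a]"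
  shows "path_algebra_iso Q Q' (subst Q Q' f)"
proof -
  interpret f: substitution Q Q' f by fact
  interpret g: substitution Q' Q g by fact
  \<comment> \<open>The quivers are quantified anew so that the statement serves for both
    composites.\<close>
  have inv: "subst Q'' Q g' (subst Q Q'' f' x) = x"
    if "substitution Q Q'' f'" "substitution Q'' Q g'" "x \<in> carrier (complete_path_algebra Q)"
      "\<And>a. a \<in> arcs Q \<Longrightarrow> subst Q'' Q g' (f' a) = path_elem Q [a]"
    for Q Q'' f' g' and x :: "('v, 'e, 'k::field) series"
  proof -
    interpret f': substitution Q Q'' f' by fact
    have "subst Q'' Q g' (subst Q Q'' f' x) = subst Q Q (\<lambda>a. subst Q'' Q g' (f' a)) x"
      by (rule subst_subst[OF that(1,2)])
    also have "\<dots> = subst Q Q (\<lambda>a. path_elem Q [a]) x"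
      using that(3,4) by (intro subst_cong) (auto simp: carrier_iff paths_def pre_digraph.awalk_def)
    finally show ?thesis using that(3) by (simp add: f'.Q.subst_id)
  qed
  have "bij_betw (subst Q Q' f) (carrier (complete_path_algebra Q)) (carrier (complete_path_algebra Q'))"
    using inv[OF f g _ gf] inv[OF g f _ fg]
    by (intro bij_betwI[where g = "subst Q' Q g"]) (auto simp: f.subst_closed g.subst_closed)
  then show ?thesis
    unfolding path_algebra_iso_def ring_iso_def
    by (auto simp: f.subst_ring_hom subst_scale f.subst_lazy)
qed

lemma path_algebra_iso_comp:
  assumes "path_algebra_iso Q Q' \<phi>" "path_algebra_iso Q' Q'' \<psi>" "verts Q' = verts Q"
  shows "path_algebra_iso Q Q'' (\<psi> \<circ> \<phi>)"
proof -
  have "\<phi> x \<in> carrier (complete_path_algebra Q')" if "x \<in> carrier (complete_path_algebra Q)" for x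
    using assms(1) that unfolding path_algebra_iso_def ring_iso_def by (auto dest: ring_hom_closed)
  then show ?thesis
    using assms ring_iso_set_trans[of \<phi> _ _ \<psi>] unfolding path_algebra_iso_def by auto
qed

section \<open>Cyclic equivalence\<close>

lemma cyclically_equivalent_refl: "cyclically_equivalent Q W W"
  unfolding cyclically_equivalent_def adic_closure_def
  by (auto intro!: bexI[OF _ series.span_zero])

lemma (in substitution) subst_span_commutators:
  assumes "y \<in> series.span (commutators Q)"
  shows "subst Q Q' f y \<in> series.span (commutators Q')"
  using assms
proof (induction rule: series.span_induct_alt)
  case base
  then show ?case by (simp only: subst_zero series.span_zero)
next
  case (step c x y)
  then obtain a b where x: "x = series_mult Q a b - series_mult Q b a"
    by (auto simp: commutators_def)
  have "subst Q Q' f x \<in> commutators Q'"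
    unfolding commutators_def x
    by (intro CollectI exI conjI) (simp only: subst_diff subst_mult, rule subst_closed, rule subst_closed)
  with step show ?case
    unfolding subst_add subst_scale
    by (intro series.span_add series.span_scale series.span_base[of "subst Q Q' f x"])
qed

text \<open>Commutators go to commutators, and by \<open>subst_cong_low\<close> an approximation
  below length \<open>n\<close> stays one below length \<open>n\<close>; so the closure is respected
  as well.\<close>

lemma (in substitution) cyclically_equivalent_subst:
  assumes "cyclically_equivalent Q W W'"
  shows "cyclically_equivalent Q' (subst Q Q' f W) (subst Q Q' f W')"
  unfolding cyclically_equivalent_def adic_closure_def
proof (intro CollectI allI)
  fix n
  obtain y where y: "y \<in> series.span (commutators Q)"
      "\<And>u w. length w < n \<Longrightarrow> (W - W') (u, w) = y (u, w)"
    using assms unfolding cyclically_equivalent_def adic_closure_def by blast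
  have "(subst Q Q' f W - subst Q Q' f W') (u, v) = subst Q Q' f y (u, v)" if "length v < n" for u v
    using subst_cong_low[where x = "W - W'" and y = y, OF y(2) that] by (simp only: subst_diff)
  with subst_span_commutators[OF y(1)]
  show "\<exists>y\<in>series.span (commutators Q'). \<forall>u w. length w < n \<longrightarrow>
      (subst Q Q' f W - subst Q Q' f W') (u, w) = y (u, w)" by blast
qed

lemma (in wf_digraph) single_rotate_commutator:
  assumes "awalk u (w1 @ w2) u"
  shows "single (u, w1 @ w2) 1 - single (awlast u w1, w2 @ w1) 1
    \<in> (commutators G :: ('a, 'b, 'k::field) series set)"
proof -
  let ?x = "single (u, w1) 1 :: ('a, 'b, 'k) series"
  let ?y = "single (awlast u w1, w2) 1 :: ('a, 'b, 'k) series"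
  have w: "awalk u w1 (awlast u w1)" "awalk (awlast u w1) w2 u"
    using assms by auto
  have "?x \<in> carrier (complete_path_algebra G)" "?y \<in> carrier (complete_path_algebra G)"
    using w by (auto simp: carrier_iff single_apply paths_def split: if_splits)
  moreover have "series_mult G ?x ?y = single (u, w1 @ w2) 1"
    "series_mult G ?y ?x = single (awlast u w1, w2 @ w1) 1"
    using path_end_eq[OF w(2)] by (simp_all add: series_mult_single_single)
  ultimately show ?thesis
    unfolding commutators_def by (intro CollectI exI[of _ ?x] exI[of _ ?y]) simp
qed

lemma (in fin_digraph) finite_short_paths: "finite {p. p \<in> paths G \<and> length (snd p) < n}"
proof (rule finite_subset)
  show "{p. p \<in> paths G \<and> length (snd p) < n} \<subseteq> verts G \<times> {w. set w \<subseteq> arcs G \<and> length w \<le> n}"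
    by (auto simp: paths_def awalk_def)
qed (intro finite_cartesian_product finite_lists_length_le; simp)

text \<open>Each term is rotated by an amount of its own, infinitely many at once. Rotation
  preserves length, so below length \<open>n\<close> only the finitely many terms in
  \<open>F\<close> matter, and each of them contributes one commutator.\<close>

lemma (in fin_digraph) cyclically_equivalent_rotate:
  fixes Z :: "('a, 'b, 'k::field) series"
  assumes r: "\<And>p. Z p \<noteq> 0 \<Longrightarrow>
    \<exists>u w1 w2. p = (u, w1 @ w2) \<and> awalk u (w1 @ w2) u \<and> r p = (awlast u w1, w2 @ w1)"
  shows "cyclically_equivalent G Z (\<lambda>q. \<Sum>p | Z p \<noteq> 0 \<and> r p = q. Z p)"
  unfolding cyclically_equivalent_def adic_closure_def
proof (intro CollectI allI)
  fix n
  define F where "F = {p. Z p \<noteq> 0 \<and> length (snd p) < n}"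
  define y where "y = (\<Sum>p\<in>F. series_scale (Z p) (single p 1 - single (r p) 1))"
  have paths: "p \<in> paths G" "length (snd (r p)) = length (snd p)" if "Z p \<noteq> 0" for p
    using r[OF that] by (auto simp: paths_def)
  have "finite F"
    by (rule finite_subset[OF _ finite_short_paths[of n]]) (use paths in \<open>auto simp: F_def\<close>)
  have "(Z - (\<lambda>q. \<Sum>p | Z p \<noteq> 0 \<and> r p = q. Z p)) (u, w) = y (u, w)" if w: "length w < n" for u w
  proof -
    have "(\<Sum>p\<in>F. Z p * single p 1 (u, w)) = (\<Sum>p\<in>F. if p = (u, w) then Z (u, w) else 0)"
      by (rule sum.cong) (auto simp: single_apply)
    also have "\<dots> = Z (u, w)"
      using w \<open>finite F\<close> by (auto simp: F_def)
    moreover have "(\<Sum>p\<in>F. Z p * single (r p) 1 (u, w)) = (\<Sum>p | Z p \<noteq> 0 \<and> r p = (u, w). Z p)"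
    proof (rule sum.mono_neutral_cong_right[OF \<open>finite F\<close>])
      show "{p. Z p \<noteq> 0 \<and> r p = (u, w)} \<subseteq> F"
        using paths(2) w unfolding F_def by fastforce
    qed (auto simp: single_apply F_def)
    ultimately show ?thesis
      by (simp add: y_def sum_fun_apply right_diff_distrib sum_subtractf)
  qed
  moreover have "y \<in> series.span (commutators G)"
    unfolding y_def
  proof (intro series.span_sum series.span_scale series.span_base)
    fix p assume "p \<in> F"
    then have "Z p \<noteq> 0" by (simp add: F_def)
    from r[OF this] show "single p 1 - single (r p) 1 \<in> commutators G"
      by (auto intro!: single_rotate_commutator)
  qed
  ultimately show "\<exists>y\<in>series.span (commutators G). \<forall>u w. length w < n \<longrightarrow>
      (Z - (\<lambda>q. \<Sum>p | Z p \<noteq> 0 \<and> r p = q. Z p)) (u, w) = y (u, w)" by blast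
qed

text \<open>Terms that miss \<open>X\<close> stay in place. The last property then identifies the
  part of \<open>R\<close> avoiding \<open>X\<close> exactly, not only up to cyclic
  equivalence.\<close>

lemma (in fin_digraph) rotate_to_end:
  fixes Z :: "('a, 'b, 'k::field) series"
  assumes closed: "\<And>u w. Z (u, w) \<noteq> 0 \<Longrightarrow> awalk u w u"
  obtains R where "cyclically_equivalent G Z R"
    and "\<And>u w. R (u, w) \<noteq> 0 \<Longrightarrow> awalk u w u"
    and "\<And>u w. R (u, w) \<noteq> 0 \<Longrightarrow> set w \<inter> X \<noteq> {} \<Longrightarrow> last w \<in> X"
    and "\<And>u w. R (u, w) \<noteq> 0 \<Longrightarrow> \<exists>u' w'. Z (u', w') \<noteq> 0 \<and> set w' = set w"
    and "\<And>u w. set w \<inter> X = {} \<Longrightarrow> R (u, w) = Z (u, w)"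
proof -
  define rot where "rot p q \<longleftrightarrow> (\<exists>u w1 w2. p = (u, w1 @ w2) \<and> awalk u (w1 @ w2) u \<and>
      q = (awlast u w1, w2 @ w1) \<and> (set (snd p) \<inter> X = {} \<longrightarrow> q = p) \<and>
      (set (snd p) \<inter> X \<noteq> {} \<longrightarrow> last (snd q) \<in> X))" for p q
  have "\<exists>q. rot p q" if Z: "Z p \<noteq> 0" for p
  proof -
    obtain u w where p: "p = (u, w)" "awalk u w u" using closed[of "fst p" "snd p"] Z by (metis prod.collapse)
    show ?thesis
    proof (cases "set w \<inter> X = {}")
      case True
      then show ?thesis
        unfolding rot_def using p by (intro exI[of _ p] exI[of _ u] exI[of _ w] exI[of _ "[]"])
          (auto simp: path_end_eq)
    next
      case False
      then obtain a where "a \<in> set w" "a \<in> X" by auto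
      then obtain w1 w2 where "w = w1 @ a # w2" by (auto dest: split_list)
      then have "w = (w1 @ [a]) @ w2" by simp
      then show ?thesis
        unfolding rot_def using p False \<open>a \<in> X\<close>
        by (intro exI[of _ "(awlast u (w1 @ [a]), w2 @ (w1 @ [a]))"] exI[of _ u] exI[of _ "w1 @ [a]"] exI[of _ w2])
          auto
    qed
  qed
  then obtain r where r: "\<And>p. Z p \<noteq> 0 \<Longrightarrow> rot p (r p)" by metis
  define R where "R = (\<lambda>q. \<Sum>p | Z p \<noteq> 0 \<and> r p = q. Z p)"
  have R: "\<exists>p. Z p \<noteq> 0 \<and> rot p q" if "R q \<noteq> 0" for q
  proof -
    from that obtain p where "p \<in> {p. Z p \<noteq> 0 \<and> r p = q}" unfolding R_def by (meson sum.neutral)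
    then show ?thesis using r by blast
  qed
  show thesis
  proof (rule that)
    show "cyclically_equivalent G Z R"
      unfolding R_def by (rule cyclically_equivalent_rotate) (use r rot_def in blast)
  next
    fix u w assume "R (u, w) \<noteq> 0"
    then obtain p where p: "Z p \<noteq> 0" "rot p (u, w)" using R by blast
    then show "awalk u w u" by (auto simp: rot_def)
    from p(2) obtain u' w1 w2 where "p = (u', w1 @ w2)" "w = w2 @ w1" by (auto simp: rot_def)
    with p(1) show "\<exists>u' w'. Z (u', w') \<noteq> 0 \<and> set w' = set w"
      by (intro exI[of _ u'] exI[of _ "w1 @ w2"]) auto
    assume "set w \<inter> X \<noteq> {}"
    then show "last w \<in> X" using p by (auto simp: rot_def)
  next
    fix u w assume w: "set w \<inter> X = {}"
    \<comment> \<open>Rotation keeps the set of arrows, so a term that lands on a path missing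
      \<open>X\<close> misses \<open>X\<close> itself and was not moved.\<close>
    have "{p. Z p \<noteq> 0 \<and> r p = (u, w)} = (if Z (u, w) = 0 then {} else {(u, w)})"
    proof -
      have "p = (u, w)" if "Z p \<noteq> 0" "r p = (u, w)" for p
      proof -
        from r[OF that(1)] obtain u' w1 w2 where *: "p = (u', w1 @ w2)" "r p = (awlast u' w1, w2 @ w1)"
            "set (snd p) \<inter> X = {} \<longrightarrow> r p = p" unfolding rot_def by blast
        with that(2) w have "set (snd p) \<inter> X = {}" by auto
        with *(3) that(2) show ?thesis by simp
      qed
      moreover have "r (u, w) = (u, w)" if "Z (u, w) \<noteq> 0"
        using r[OF that] w unfolding rot_def by auto
      ultimately show ?thesis by auto
    qed
    then show "R (u, w) = Z (u, w)" by (simp add: R_def)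
  qed
qed

section \<open>Unitriangular automorphisms\<close>

text \<open>The projection that sets the arrows of \<open>X\<close> to zero. It is multiplicative
  because a path avoids \<open>X\<close> if and only if both pieces of any cut do.\<close>

definition avoiding :: "'a set \<Rightarrow> ('v, 'a, 'k::field) series \<Rightarrow> ('v, 'a, 'k) series" where
  "avoiding X x = (\<lambda>(u, w). if set w \<inter> X = {} then x (u, w) else 0)"

lemma avoiding_apply: "avoiding X x (u, w) = (if set w \<inter> X = {} then x (u, w) else 0)"
  by (simp add: avoiding_def)

lemma avoiding_eq_iff: "avoiding X x = x \<longleftrightarrow> (\<forall>u w. x (u, w) \<noteq> 0 \<longrightarrow> set w \<inter> X = {})"
  by (auto simp: avoiding_def fun_eq_iff)

lemma avoiding_mult:
  fixes x y :: "('v, 'a, 'k::field) series"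
  shows "avoiding X (series_mult Q x y) = series_mult Q (avoiding X x) (avoiding X y)"
proof (rule ext, clarify)
  fix u and w :: "'a list"
  have "set w = set (take n w) \<union> set (drop n w)" for n
    by (metis append_take_drop_id set_append)
  then have *: "set w \<inter> X = {} \<longleftrightarrow> set (take n w) \<inter> X = {} \<and> set (drop n w) \<inter> X = {}" for n
    by auto
  have "avoiding X x (u, take n w) * avoiding X y (path_end Q u (take n w), drop n w) =
      (if set w \<inter> X = {} then x (u, take n w) * y (path_end Q u (take n w), drop n w) else 0)" for n
    using *[of n] by (auto simp: avoiding_apply)
  then show "avoiding X (series_mult Q x y) (u, w) = series_mult Q (avoiding X x) (avoiding X y) (u, w)"
    by (simp add: avoiding_apply series_mult_apply)
qed

lemma avoiding_lazy: "avoiding X (lazy i) = lazy i"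
  by (auto simp: avoiding_eq_iff lazy_def single_apply split: if_splits)

lemma avoiding_zero: "avoiding X 0 = 0"
  by (auto simp: avoiding_eq_iff)

lemma avoiding_subst_path:
  "avoiding X (subst_path Q Q' f w u) = subst_path Q Q' (\<lambda>a. avoiding X (f a)) w u"
  by (induction w arbitrary: u) (simp_all only: subst_path.simps avoiding_mult avoiding_lazy avoiding_zero if_distrib[of "avoiding X"])

lemma avoiding_subst: "avoiding X (subst Q Q' f x) = subst Q Q' (\<lambda>a. avoiding X (f a)) x"
proof (rule ext, clarify)
  fix u v
  show "avoiding X (subst Q Q' f x) (u, v) = subst Q Q' (\<lambda>a. avoiding X (f a)) x (u, v)"
    by (auto simp: avoiding_apply subst_apply avoiding_subst_path[symmetric])
qed

lemma path_elem_arrow_apply: "path_elem Q [a] (u, w) = (if u = tail Q a \<and> w = [a] then 1 else 0)"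
  by (simp add: path_elem_def single_apply)

lemma series_mult_arrow_right:
  fixes x :: "('v, 'a, 'k::field) series"
  shows "series_mult Q x (path_elem Q [a]) (u, v) =
    (if v \<noteq> [] \<and> last v = a \<and> path_end Q u (butlast v) = tail Q a then x (u, butlast v) else 0)"
proof (cases "v \<noteq> [] \<and> last v = a \<and> path_end Q u (butlast v) = tail Q a")
  case True
  then have v: "v = butlast v @ [a]" by auto
  have "x (u, take n v) * path_elem Q [a] (path_end Q u (take n v), drop n v) =
      (if n = length v - 1 then x (u, butlast v) else 0)" if "n \<le> length v" for n
  proof (cases "n = length v - 1")
    case True
    moreover have "drop (length v - 1) v = [a]" by (subst v) simp
    ultimately show ?thesis using \<open>v \<noteq> [] \<and> _\<close>
      by (simp add: path_elem_arrow_apply butlast_conv_take)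
  next
    case False
    then have "length (drop n v) \<noteq> length [a]" using that by simp
    then have "drop n v \<noteq> [a]" by metis
    then show ?thesis using False by (simp add: path_elem_arrow_apply)
  qed
  then show ?thesis using True by (simp add: series_mult_apply)
next
  case False
  have "series_mult Q x (path_elem Q [a]) (u, v) = 0"
  proof (rule ccontr)
    assume "series_mult Q x (path_elem Q [a]) (u, v) \<noteq> 0"
    then obtain w1 w2 where "v = w1 @ w2" "path_elem Q [a] (path_end Q u w1, w2) \<noteq> (0 :: 'k)"
      by (rule series_mult_nonzeroE)
    with False show False by (auto simp: path_elem_arrow_apply split: if_splits)
  qed
  with False show ?thesis by auto
qed

text \<open>A path that meets \<open>X\<close> factors through its last arrow and so occurs in
  exactly one summand. Since \<open>R\<close> is supported on paths, the endpoint condition in the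
  product is automatic.\<close>

lemma (in fin_digraph) split_last_arrow:
  assumes "finite X" "X \<subseteq> arcs G"
    and R: "\<And>u w. R (u, w) \<noteq> 0 \<Longrightarrow> (u, w) \<in> paths G \<and> (set w \<inter> X \<noteq> {} \<longrightarrow> last w \<in> X)"
  shows "R = avoiding X R + (\<Sum>a\<in>X. series_mult G (\<lambda>(u, w). R (u, w @ [a])) (path_elem G [a]))"
proof (rule ext, clarify)
  fix u w
  let ?t = "\<lambda>a. series_mult G (\<lambda>(u, w). R (u, w @ [a])) (path_elem G [a]) (u, w)"
  have t: "?t a = (if a = last w then (if w \<noteq> [] then R (u, w) else 0) else 0)" if "a \<in> X" for a
  proof (cases "w \<noteq> [] \<and> last w = a")
    case True
    then have w: "butlast w @ [a] = w" by auto
    have "path_end G u (butlast w) = tail G a" if "R (u, w) \<noteq> 0"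
    proof -
      from R[OF that] obtain v where "awalk u (butlast w @ [a]) v" unfolding w paths_def by auto
      then show ?thesis by (auto simp: awalk_simps)
    qed
    then show ?thesis using True w by (auto simp: series_mult_arrow_right)
  qed (auto simp: series_mult_arrow_right)
  have "(\<Sum>a\<in>X. ?t a) = (if last w \<in> X \<and> w \<noteq> [] then R (u, w) else 0)"
    using \<open>finite X\<close> by (subst sum.cong[OF refl t]) auto
  moreover have "R (u, w) = avoiding X R (u, w) + (if last w \<in> X \<and> w \<noteq> [] then R (u, w) else 0)"
  proof (cases "w = []")
    case False
    then have "set w \<inter> X \<noteq> {}" if "last w \<in> X"
      using that last_in_set by blast
    then show ?thesis using R[of u w] False by (auto simp: avoiding_apply)
  qed (simp add: avoiding_apply)
  ultimately show "R (u, w) = (avoiding X R + (\<Sum>a\<in>X. series_mult G (\<lambda>(u, w). R (u, w @ [a])) (path_elem G [a]))) (u, w)"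
    by (simp add: sum_fun_apply)
qed

definition shift_arrows :: "('v, 'a) pre_digraph \<Rightarrow> 'a set \<Rightarrow> ('a \<Rightarrow> ('v, 'a, 'k::field) series)
    \<Rightarrow> 'a \<Rightarrow> ('v, 'a, 'k) series" where
  "shift_arrows Q X h a = path_elem Q [a] + (if a \<in> X then h a else 0)"

text \<open>By \<open>avoids\<close>, the added series \<open>h a\<close> involves only arrows that
  the shift fixes. The shift is thus unitriangular, and its inverse is the shift by
  \<open>- h\<close>.\<close>

locale arrow_shift = fin_digraph G for G :: "('v, 'a) pre_digraph" +
  fixes X :: "'a set" and h :: "'a \<Rightarrow> ('v, 'a, 'k::field) series"
  assumes parallel: "a \<in> X \<Longrightarrow> parallel_series G (tail G a) (head G a) (h a)"
    and avoids: "a \<in> X \<Longrightarrow> avoiding X (h a) = h a"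
begin

lemma substitution: "substitution G G (shift_arrows G X h)"
proof unfold_locales
  fix a assume a: "a \<in> arcs G"
  show "parallel_series G (tail G a) (head G a) (shift_arrows G X h a)"
    unfolding parallel_series_def
  proof (intro allI impI)
    fix s w assume "shift_arrows G X h a (s, w) \<noteq> 0"
    then consider "s = tail G a" "w = [a]" | "a \<in> X" "h a (s, w) \<noteq> 0"
      by (auto simp: shift_arrows_def path_elem_arrow_apply split: if_splits)
    then show "s = tail G a \<and> w \<noteq> [] \<and> awalk (tail G a) w (head G a)"
      using a parallel_seriesD[OF parallel[of a]] by cases (auto simp: awalk_simps)
  qed
qed simp

lemma subst_fixes:
  assumes x: "x \<in> carrier (complete_path_algebra G)" and "avoiding X x = x"
  shows "subst G G (shift_arrows G X h) x = x"
proof -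
  have "subst G G (shift_arrows G X h) x = subst G G (\<lambda>a. path_elem G [a]) x"
    using assms(2) unfolding avoiding_eq_iff
    by (intro subst_cong) (auto simp: shift_arrows_def)
  with subst_id[OF x] show ?thesis by simp
qed

lemma neg: "arrow_shift G X (\<lambda>a. - h a)"
proof unfold_locales
  fix a assume "a \<in> X"
  with parallel avoids show "parallel_series G (tail G a) (head G a) (- h a)" "avoiding X (- h a) = - h a"
    by (auto simp: parallel_series_def avoiding_eq_iff)
qed

lemma in_carrier: "a \<in> X \<Longrightarrow> h a \<in> carrier (complete_path_algebra G)"
  using parallel[of a] by (auto simp: carrier_iff parallel_series_def paths_def)

lemma subst_shift_inverse:
  assumes a: "a \<in> arcs G"
  shows "subst G G (shift_arrows G X (\<lambda>a. - h a)) (shift_arrows G X h a) = path_elem G [a]"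
proof -
  interpret n: arrow_shift G X "\<lambda>a. - h a" by (rule neg)
  interpret s: substitution G G "shift_arrows G X (\<lambda>a. - h a)" by (rule n.substitution)
  show ?thesis
  proof (cases "a \<in> X")
    case True
    have "subst G G (shift_arrows G X (\<lambda>a. - h a)) (shift_arrows G X h a) =
        shift_arrows G X (\<lambda>a. - h a) a + h a"
      unfolding shift_arrows_def[of G X h] using True
      by (simp only: subst_add s.subst_arrow[OF a] if_True n.subst_fixes[OF in_carrier[OF True] avoids[OF True]])
    then show ?thesis using True by (simp add: shift_arrows_def)
  next
    case False
    then show ?thesis by (simp add: shift_arrows_def[of G X h] s.subst_arrow[OF a])
      (simp add: shift_arrows_def)
  qed
qed

lemma iso: "path_algebra_iso G G (subst G G (shift_arrows G X h))"
proof -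
  interpret n: arrow_shift G X "\<lambda>a. - h a" by (rule neg)
  show ?thesis
    using subst_shift_inverse n.subst_shift_inverse
    by (intro path_algebra_iso_subst[OF substitution n.substitution]) simp_all
qed

end

section \<open>Relabelling\<close>

lemma series_extend_nonzeroE:
  assumes "series_extend f x q \<noteq> 0"
  obtains p where "x p \<noteq> 0" "f p q \<noteq> 0"
proof -
  have "{p. x p \<noteq> 0 \<and> f p q \<noteq> 0} \<noteq> {}"
  proof
    assume "{p. x p \<noteq> 0 \<and> f p q \<noteq> 0} = {}"
    with assms show False by (simp only: series_extend_def sum.empty simp_thms)
  qed
  with that show thesis by blast
qed

lemma series_extend_cong:
  assumes "\<And>p. x p \<noteq> 0 \<Longrightarrow> f p = g p"
  shows "series_extend f x = series_extend g x"
proof -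
  have "{p. x p \<noteq> 0 \<and> f p q \<noteq> 0} = {p. x p \<noteq> 0 \<and> g p q \<noteq> 0}" for q using assms by auto
  then show ?thesis unfolding series_extend_def using assms by (auto intro!: sum.cong ext)
qed

text \<open>The paths contributing to a coefficient are among the short words at its start vertex,
  so both sums agree. This identifies substitutions with the maps \<open>map_arrows\<close> and
  \<open>star_potential\<close>, which are defined by \<open>series_extend\<close>.\<close>

lemma (in substitution) subst_eq_series_extend:
  assumes "\<And>u w. x (u, w) \<noteq> 0 \<Longrightarrow> subst_path Q Q' f w u = g (u, w)"
  shows "subst Q Q' f x = series_extend g x"
proof -
  have "subst Q Q' f x = series_extend (\<lambda>(u, w). subst_path Q Q' f w u) x"
  proof (rule ext, clarify)
    fix u v
    have "(\<Sum>w\<in>words Q (length v). x (u, w) * subst_path Q Q' f w u (u, v)) =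
        (\<Sum>p\<in>Pair u ` words Q (length v). x p * (case p of (u, w) \<Rightarrow> subst_path Q Q' f w u) (u, v))"
      by (subst sum.reindex) (auto simp: inj_on_def)
    also have "\<dots> = (\<Sum>p | x p \<noteq> 0 \<and> (case p of (u, w) \<Rightarrow> subst_path Q Q' f w u) (u, v) \<noteq> 0.
        x p * (case p of (u, w) \<Rightarrow> subst_path Q Q' f w u) (u, v))"
    proof (rule sum.mono_neutral_right)
      show "{p. x p \<noteq> 0 \<and> (case p of (u, w) \<Rightarrow> subst_path Q Q' f w u) (u, v) \<noteq> 0} \<subseteq> Pair u ` words Q (length v)"
        using subst_path_nonzero[of _ _ u v] by (fastforce simp: words_def Q.awalk_def)
    qed auto
    finally show "subst Q Q' f x (u, v) = series_extend (\<lambda>(u, w). subst_path Q Q' f w u) x (u, v)"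
      by (simp add: subst_apply series_extend_def)
  qed
  also have "\<dots> = series_extend g x"
    using assms by (intro series_extend_cong) auto
  finally show ?thesis .
qed

lemma (in substitution) subst_path_monomial:
  assumes f: "\<And>a. a \<in> set w \<Longrightarrow> f a = single (tail Q a, s a) (c a)"
    and s: "\<And>a. a \<in> set w \<Longrightarrow> Q'.awalk (tail Q a) (s a) (head Q a)"
    and w: "(u, w) \<in> paths Q"
  shows "subst_path Q Q' f w u = single (u, concat (map s w)) (prod_list (map c w))"
  using assms
proof (induction w arbitrary: u)
  case Nil
  then show ?case by (auto simp: paths_def Q.awalk_simps lazy_def)
next
  case (Cons a w)
  then have a: "a \<in> arcs Q" "tail Q a = u" "(head Q a, w) \<in> paths Q"
    by (auto simp: paths_def Q.awalk_simps)
  have "subst_path Q Q' f w (head Q a) = single (head Q a, concat (map s w)) (prod_list (map c w))"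
    using Cons a by auto
  then show ?case using a Cons.prems(1)[of a] path_end_eq[OF Cons.prems(2)[of a]]
    by (simp add: series_mult_single_single)
qed

text \<open>Common form of \<open>bracket\<close> and \<open>map_arrows\<close>. For injective
  \<open>g\<close> every coefficient of the result is zero or a single coefficient of the argument,
  which is what yields additivity.\<close>

definition relabel :: "('p \<Rightarrow> 'q) \<Rightarrow> ('p \<Rightarrow> 'k::field) \<Rightarrow> 'q \<Rightarrow> 'k" where
  "relabel g = series_extend (\<lambda>p. single (g p) 1)"

lemma relabel_apply:
  assumes "inj g"
  shows "relabel g x (g p) = x p"
proof -
  have "relabel g x (g p) = (\<Sum>p' | x p' \<noteq> 0 \<and> g p' = g p. x p')"
    unfolding relabel_def series_extend_def by (rule sum.cong) (auto simp: single_apply)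
  also have "{p'. x p' \<noteq> 0 \<and> g p' = g p} = (if x p = 0 then {} else {p})"
    using injD[OF assms] by auto
  finally show ?thesis by simp
qed

lemma relabel_nonzeroE:
  fixes x :: "'p \<Rightarrow> 'k::field"
  assumes "relabel g x q \<noteq> 0"
  obtains p where "x p \<noteq> 0" "q = g p"
  using assms unfolding relabel_def
  by (rule series_extend_nonzeroE) (use that in \<open>auto simp: single_apply split: if_splits\<close>)

lemma relabel_outside: "q \<notin> range g \<Longrightarrow> relabel g x q = 0"
  by (rule ccontr) (erule relabel_nonzeroE, simp)

lemma relabel_add:
  assumes "inj g"
  shows "relabel g (x + y) = relabel g x + relabel g y"
proof
  fix q
  show "relabel g (x + y) q = (relabel g x + relabel g y) q"
    by (cases "q \<in> range g") (auto simp: relabel_apply[OF assms] relabel_outside)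
qed

lemma relabel_zero: "relabel g 0 = 0"
  by (simp add: relabel_def series_extend_def fun_eq_iff)

lemma relabel_sum: "inj g \<Longrightarrow> relabel g (\<Sum>i\<in>A. x i) = (\<Sum>i\<in>A. relabel g (x i))"
  by (induction A rule: infinite_finite_induct)
    (simp_all only: sum.infinite sum.empty sum.insert relabel_zero relabel_add simp_thms)

lemma relabel_single:
  assumes "inj g"
  shows "relabel g (single p c) = single (g p) c"
proof
  fix q
  show "relabel g (single p c) q = single (g p) c q"
    using injD[OF assms] by (cases "q \<in> range g")
      (auto simp: relabel_apply[OF assms] relabel_outside single_apply)
qed

lemma series_extend_relabel:
  assumes "inj g"
  shows "series_extend F (relabel g x) = series_extend (\<lambda>p. F (g p)) x"
proof
  fix r
  have "{q. relabel g x q \<noteq> 0 \<and> F q r \<noteq> 0} = g ` {p. x p \<noteq> 0 \<and> F (g p) r \<noteq> 0}"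
    by (auto simp: relabel_apply[OF assms] elim: relabel_nonzeroE)
  then show "series_extend F (relabel g x) r = series_extend (\<lambda>p. F (g p)) x r"
    unfolding series_extend_def
    by (simp add: sum.reindex inj_on_subset[OF assms] relabel_apply[OF assms])
qed

lemma map_arrows_relabel: "map_arrows f = relabel (\<lambda>(u, w). (u, map f w))"
  by (simp add: map_arrows_def relabel_def case_prod_unfold)

lemma path_elem_append:
  assumes "path_end Q (tail Q (hd w1)) w1 = tail Q (hd w2)" "w1 \<noteq> []"
  shows "series_mult Q (path_elem Q w1) (path_elem Q w2) = path_elem Q (w1 @ w2)"
  using assms by (simp add: path_elem_def series_mult_single_single)

locale relabelling = Q: fin_digraph Q + Q': fin_digraph Q'
  for Q :: "('v, 'a) pre_digraph" and Q' :: "('v, 'b) pre_digraph" and \<rho> \<rho>' +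
  assumes verts_eq: "verts Q' = verts Q"
    and maps: "a \<in> arcs Q \<Longrightarrow> \<rho> a \<in> arcs Q' \<and> \<rho>' (\<rho> a) = a \<and> tail Q' (\<rho> a) = tail Q a \<and> head Q' (\<rho> a) = head Q a"
    and maps_back: "b \<in> arcs Q' \<Longrightarrow> \<rho>' b \<in> arcs Q \<and> \<rho> (\<rho>' b) = b"
begin

lemma substitution: "substitution Q Q' (\<lambda>a. path_elem Q' [\<rho> a])"
  by unfold_locales
    (auto simp: verts_eq parallel_series_def path_elem_arrow_apply Q'.awalk_simps maps split: if_splits)

lemma inverse: "relabelling Q' Q \<rho>' \<rho>"
proof unfold_locales
  fix b assume "b \<in> arcs Q'"
  then show "\<rho>' b \<in> arcs Q \<and> \<rho> (\<rho>' b) = b \<and> tail Q (\<rho>' b) = tail Q' b \<and> head Q (\<rho>' b) = head Q' b"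
    using maps_back[of b] maps[of "\<rho>' b"] by auto
qed (auto simp: verts_eq maps)

lemma iso: "path_algebra_iso Q Q' (subst Q Q' (\<lambda>a. path_elem Q' [\<rho> a]))"
proof -
  interpret i: relabelling Q' Q \<rho>' \<rho> by (rule inverse)
  show ?thesis
  proof (rule path_algebra_iso_subst[OF substitution i.substitution])
    fix a assume "a \<in> arcs Q"
    with maps show "subst Q' Q (\<lambda>a. path_elem Q [\<rho>' a]) (path_elem Q' [\<rho> a]) = path_elem Q [a]"
      by (simp add: substitution.subst_arrow[OF i.substitution])
  next
    fix a assume "a \<in> arcs Q'"
    with maps_back show "subst Q Q' (\<lambda>a. path_elem Q' [\<rho> a]) (path_elem Q [\<rho>' a]) = path_elem Q' [a]"
      by (simp add: substitution.subst_arrow[OF substitution])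
  qed
qed

text \<open>Links the isomorphism, which is built as a substitution, to the form in which
  \<open>direct_sum_qp\<close> gives its potential.\<close>

lemma subst_eq_map_arrows:
  fixes x :: "('v, 'a, 'k::field) series"
  assumes x: "x \<in> carrier (complete_path_algebra Q)"
  shows "subst Q Q' (\<lambda>a. path_elem Q' [\<rho> a]) x = map_arrows \<rho> x"
  unfolding map_arrows_def
proof (rule substitution.subst_eq_series_extend[OF substitution])
  fix u w assume "x (u, w) \<noteq> 0"
  then have w: "(u, w) \<in> paths Q" using x by (simp add: carrier_iff)
  then have "set w \<subseteq> arcs Q" by (auto simp: paths_def Q.awalk_def)
  then have "subst_path Q Q' (\<lambda>a. path_elem Q' [\<rho> a]) w u =
      single (u, concat (map (\<lambda>a. [\<rho> a]) w)) (prod_list (map (\<lambda>_. 1 :: 'k) w))"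
    using maps by (intro substitution.subst_path_monomial[OF substitution] w)
      (auto simp: path_elem_def Q'.awalk_simps verts_eq subset_iff)
  moreover have "prod_list (map (\<lambda>_. 1 :: 'k) w) = 1" by (induction w) auto
  ultimately show "subst_path Q Q' (\<lambda>a. path_elem Q' [\<rho> a]) w u = (case (u, w) of (u, w) \<Rightarrow> single (u, map \<rho> w) (1 :: 'k))"
    by (simp add: concat_map_singleton)
qed

end

section \<open>Words of the mutation\<close>

text \<open>Letterwise left inverse of \<open>bracket_word\<close>, from which injectivity follows.
  The value at \<open>Star a\<close> is a dummy, as bracketed words contain no such letter.\<close>

fun unbracket_arrow :: "'a mut_arrow \<Rightarrow> 'a list" where
  "unbracket_arrow (Old a) = [a]"
| "unbracket_arrow (Comp a b) = [a, b]"
| "unbracket_arrow (Star a) = []"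

lemma unbracket_word: "concat (map unbracket_arrow (bracket_word Q k w)) = w"
  by (induction Q k w rule: bracket_word.induct) auto

lemma inj_bracket: "inj (\<lambda>(u, w). (u, bracket_word Q k w))"
  by (rule inj_on_inverseI[where g = "\<lambda>(u, w). (u, concat (map unbracket_arrow w))"])
    (auto simp: unbracket_word)

lemma bracket_relabel: "bracket Q k = relabel (\<lambda>(u, w). (u, bracket_word Q k w))"
  by (simp add: bracket_def relabel_def case_prod_unfold)

lemma Star_notin_bracket_word: "Star a \<notin> set (bracket_word Q k w)"
  by (induction Q k w rule: bracket_word.induct) auto

text \<open>Turns the absence of matched paths from \<open>S\<close> into the absence of matched
  composite arrows from [S].\<close>

lemma Comp_in_bracket_word: "Comp a b \<in> set (bracket_word Q k w) \<Longrightarrow> sublist [a, b] w"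
proof (induction Q k w rule: bracket_word.induct)
  case (3 Q k c d w)
  then show ?case
    by (auto simp: sublist_Cons_right split: if_splits)
qed auto

text \<open>The families of the matching are merged into \<open>P\<close>, \<open>G\<close> and one
  bijection. Maximality enters only through its consequence that, beside an unmatched pair, all
  arrows in the opposite direction are used up by the matching.\<close>

locale matched_vertex = fin_digraph Q + loopfree_digraph Q for Q :: "('v, 'a) pre_digraph" +
  fixes k :: 'v and P :: "('a \<times> 'a) set" and G :: "'a set" and m :: "'a \<times> 'a \<Rightarrow> 'a"
  assumes no_two_cycles: "no_two_cycles Q"
    and P_through: "P \<subseteq> through Q k"
    and G_arcs: "\<gamma> \<in> G \<Longrightarrow> \<gamma> \<in> arcs Q \<and> tail Q \<gamma> \<noteq> k \<and> head Q \<gamma> \<noteq> k"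
    and m_bij: "bij_betw m P G"
    and m_ends: "(\<alpha>, \<beta>) \<in> P \<Longrightarrow> tail Q (m (\<alpha>, \<beta>)) = head Q \<beta> \<and> head Q (m (\<alpha>, \<beta>)) = tail Q \<alpha>"
    and maximal: "(\<alpha>, \<beta>) \<in> through Q k - P \<Longrightarrow> c \<in> arcs Q \<Longrightarrow> tail Q c = head Q \<beta> \<Longrightarrow> head Q c = tail Q \<alpha> \<Longrightarrow> c \<in> G"
begin

abbreviation "Qt \<equiv> premutation_quiver Q k"
abbreviation "M \<equiv> mutation_quiver Q k P G"
abbreviation "pin \<equiv> partner_in P m"
abbreviation "pout \<equiv> partner_out P m"

lemma partners:
  assumes "\<gamma> \<in> G"
  shows "(pin \<gamma>, pout \<gamma>) \<in> P" "m (pin \<gamma>, pout \<gamma>) = \<gamma>"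
    and "pin \<gamma> \<in> arcs Q" "pout \<gamma> \<in> arcs Q" "head Q (pin \<gamma>) = k" "tail Q (pout \<gamma>) = k"
    and "tail Q \<gamma> = head Q (pout \<gamma>)" "head Q \<gamma> = tail Q (pin \<gamma>)"
proof -
  have "\<gamma> \<in> m ` P" using m_bij assms by (simp add: bij_betw_def)
  then have "inv_into P m \<gamma> \<in> P" "m (inv_into P m \<gamma>) = \<gamma>"
    by (auto intro: inv_into_into f_inv_into_f)
  then show *: "(pin \<gamma>, pout \<gamma>) \<in> P" "m (pin \<gamma>, pout \<gamma>) = \<gamma>"
    by (auto simp: partner_in_def partner_out_def)
  from *(1) P_through show "pin \<gamma> \<in> arcs Q" "pout \<gamma> \<in> arcs Q" "head Q (pin \<gamma>) = k" "tail Q (pout \<gamma>) = k"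
    by (auto simp: through_def)
  from m_ends[OF *(1)] show "tail Q \<gamma> = head Q (pout \<gamma>)" "head Q \<gamma> = tail Q (pin \<gamma>)"
    by (simp_all add: *(2))
qed

lemma partners_m:
  assumes "(\<alpha>, \<beta>) \<in> P"
  shows "m (\<alpha>, \<beta>) \<in> G" "pin (m (\<alpha>, \<beta>)) = \<alpha>" "pout (m (\<alpha>, \<beta>)) = \<beta>"
  using m_bij assms by (auto simp: bij_betw_def partner_in_def partner_out_def)

lemma bij_partners: "bij_betw (\<lambda>\<gamma>. (pin \<gamma>, pout \<gamma>)) G P"
  by (rule bij_betwI[where g = m]) (auto simp: partners partners_m)

lemma finite_through: "finite (through Q k)"
  by (rule finite_subset[of _ "arcs Q \<times> arcs Q"]) (auto simp: through_def)

lemma finite_P [simp]: "finite P"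
  using P_through finite_through by (rule finite_subset)

lemma finite_G [simp]: "finite G"
  using G_arcs by (intro finite_subset[OF _ finite_arcs]) auto

lemma premutation_simps [simp]:
  "verts Qt = verts Q"
  "tail Qt (Old a) = tail Q a" "tail Qt (Comp \<alpha> \<beta>) = tail Q \<alpha>" "tail Qt (Star a) = head Q a"
  "head Qt (Old a) = head Q a" "head Qt (Comp \<alpha> \<beta>) = head Q \<beta>" "head Qt (Star a) = tail Q a"
  by (simp_all add: premutation_quiver_def)

lemma arcs_premutation:
  "Old a \<in> arcs Qt \<longleftrightarrow> a \<in> arcs Q \<and> tail Q a \<noteq> k \<and> head Q a \<noteq> k"
  "Comp \<alpha> \<beta> \<in> arcs Qt \<longleftrightarrow> (\<alpha>, \<beta>) \<in> through Q k"
  "Star a \<in> arcs Qt \<longleftrightarrow> a \<in> arcs Q \<and> (tail Q a = k \<or> head Q a = k)"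
  by (auto simp: premutation_quiver_def)

lemma mutation_simps [simp]: "verts M = verts Q" "tail M = tail Qt" "head M = head Qt"
  by (simp_all add: mutation_quiver_def)

text \<open>The arrows by which \<open>Qt\<close> exceeds \<open>M\<close>, separated according to
  which of the two automorphisms shifts them.\<close>

definition "matched_old = Old ` G"
definition "matched_comp = (\<lambda>(\<alpha>, \<beta>). Comp \<alpha> \<beta>) ` P"

lemma matched_iff [simp]:
  "Old a \<in> matched_old \<longleftrightarrow> a \<in> G" "Comp \<alpha> \<beta> \<notin> matched_old" "Star a \<notin> matched_old"
  "Old a \<notin> matched_comp" "Comp \<alpha> \<beta> \<in> matched_comp \<longleftrightarrow> (\<alpha>, \<beta>) \<in> P" "Star a \<notin> matched_comp"
  by (auto simp: matched_old_def matched_comp_def)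

lemma arcs_mutation: "arcs M = arcs Qt - matched_old - matched_comp"
  by (simp add: mutation_quiver_def matched_old_def matched_comp_def)

lemma matched_subset: "matched_old \<subseteq> arcs Qt" "matched_comp \<subseteq> arcs Qt"
  using P_through G_arcs by (auto simp: matched_old_def matched_comp_def arcs_premutation)

lemma finite_matched: "finite matched_old" "finite matched_comp"
  by (simp_all add: matched_old_def matched_comp_def)

lemma fin_digraph_premutation: "fin_digraph Qt"
proof unfold_locales
  fix e assume "e \<in> arcs Qt"
  then show "tail Qt e \<in> verts Qt" "head Qt e \<in> verts Qt"
    by (cases e; auto simp: arcs_premutation through_def)+
next
  show "finite (arcs Qt)" using finite_through by (auto simp: premutation_quiver_def)
qed simp

lemma fin_digraph_mutation: "fin_digraph M"
proof -
  interpret t: fin_digraph Qt by (rule fin_digraph_premutation)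
  show ?thesis by unfold_locales (use t.tail_in_verts t.head_in_verts in \<open>auto simp: arcs_mutation\<close>)
qed

text \<open>\<open>M\<close> and \<open>Qt\<close> share \<open>tail\<close> and
  \<open>head\<close>, so potentials on \<open>M\<close> can be handled as series over
  \<open>Qt\<close> that avoid the matched arrows.\<close>

lemma awalk_mutation_iff:
  "pre_digraph.awalk M u w v \<longleftrightarrow>
    pre_digraph.awalk Qt u w v \<and> set w \<inter> matched_old = {} \<and> set w \<inter> matched_comp = {}"
proof -
  have "pre_digraph.cas M u w v = pre_digraph.cas Qt u w v"
    by (induction w arbitrary: u) (simp_all add: pre_digraph.cas.simps)
  then show ?thesis by (auto simp: pre_digraph.awalk_def arcs_mutation)
qed

lemma awalk_bracket_word:
  assumes "awalk u w v" "u \<noteq> k" "v \<noteq> k"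
  shows "pre_digraph.awalk Qt u (bracket_word Q k w) v"
proof -
  interpret t: fin_digraph Qt by (rule fin_digraph_premutation)
  show ?thesis using assms
  proof (induction w arbitrary: u rule: induct_list012)
    case (3 a b w)
    show ?case
    proof (cases "head Q a = k")
      case True
      from 3(3) True have b: "b \<in> arcs Q" "tail Q b = k" "awalk (head Q b) w v"
        and a: "a \<in> arcs Q" "tail Q a = u" by (auto simp: awalk_simps)
      \<comment> \<open>Without loops the walk leaves \<open>k\<close> after the pair, so the rest
        again satisfies the induction hypothesis.\<close>
      have "head Q b \<noteq> k" using no_loops[of b] b by simp
      with 3(1)[OF b(3)] 3(5) a b True show ?thesis
        by (simp add: t.awalk_Cons_iff arcs_premutation through_def)
    next
      case False
      from 3(3) have "awalk (head Q a) (b # w) v" "a \<in> arcs Q" "tail Q a = u"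
        by (simp_all add: awalk_Cons_iff)
      with 3(2)[of "head Q a"] 3(4,5) False show ?thesis
        by (simp add: t.awalk_Cons_iff arcs_premutation)
    qed
  qed (auto simp: awalk_simps t.awalk_simps arcs_premutation)
qed

definition star_arrow :: "'a mut_arrow \<Rightarrow> 'a mut_arrow list" where
  "star_arrow x = (case x of
      Old a \<Rightarrow> if a \<in> G then [Star (pout a), Star (pin a)] else [Old a]
    | _ \<Rightarrow> [x])"

definition star_sign :: "'a mut_arrow \<Rightarrow> 'k::field" where
  "star_sign x = (if x \<in> matched_old then - 1 else 1)"

lemma star_word_eq: "star_word Q k P G m w = concat (map star_arrow (bracket_word Q k w))"
  by (simp add: star_word_def star_arrow_def[abs_def])

text \<open>Arrows absorbed into a composite are incident with \<open>k\<close>, hence outside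
  \<open>G\<close>; so the signs may be counted before or after bracketing.\<close>

lemma prod_star_sign:
  assumes "awalk u w v" "v \<noteq> k"
  shows "prod_list (map star_sign (bracket_word Q k w)) = (- 1 :: 'k::field) ^ length (filter (\<lambda>a. a \<in> G) w)"
  using assms
proof (induction w arbitrary: u rule: induct_list012)
  case (3 a b w)
  have G: "x \<notin> G" if "tail Q x = k \<or> head Q x = k" for x using G_arcs that by auto
  show ?case
  proof (cases "head Q a = k")
    case True
    with 3 have "a \<notin> G" "b \<notin> G" "awalk (head Q b) w v" by (auto simp: awalk_simps intro!: G)
    with 3 True show ?thesis by (simp add: star_sign_def)
  next
    case False
    from 3(3) have "awalk (head Q a) (b # w) v" by (simp add: awalk_Cons_iff)
    from 3(2)[OF this 3(4)] show ?thesis using False by (simp add: star_sign_def)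
  qed
qed (auto simp: star_sign_def)

end

section \<open>Splitting off the matched pairs\<close>

locale matched_potential = matched_vertex Q k P G m
  for Q :: "('v, 'a) pre_digraph" and k P G m +
  fixes S :: "('v, 'a, 'k::field) series"
  assumes S_closed: "S (u, w) \<noteq> 0 \<Longrightarrow> awalk u w u \<and> 2 \<le> length w"
    and S_start: "S (k, w) = 0"
    and S_avoids: "S (u, w) \<noteq> 0 \<Longrightarrow> (\<alpha>, \<beta>) \<in> P \<Longrightarrow> \<not> sublist [\<alpha>, \<beta>] w"
begin

sublocale t: fin_digraph Qt
  by (rule fin_digraph_premutation)

definition old_shift :: "'a mut_arrow \<Rightarrow> ('v, 'a mut_arrow, 'k) series" where
  "old_shift x = (case x of Old \<gamma> \<Rightarrow> - path_elem Qt [Star (pout \<gamma>), Star (pin \<gamma>)] | _ \<Rightarrow> 0)"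

lemma old_shift_nonzero:
  assumes "old_shift x (s, w) \<noteq> 0" "x \<in> matched_old"
  obtains \<gamma> where "x = Old \<gamma>" "\<gamma> \<in> G" "s = head Q (pout \<gamma>)" "w = [Star (pout \<gamma>), Star (pin \<gamma>)]"
  using assms by (auto simp: old_shift_def matched_old_def path_elem_def single_apply split: if_splits)

sublocale s: arrow_shift Qt matched_old old_shift
proof unfold_locales
  fix x assume x: "x \<in> matched_old"
  show "parallel_series Qt (tail Qt x) (head Qt x) (old_shift x)"
    unfolding parallel_series_def
  proof (intro allI impI)
    fix s w assume "old_shift x (s, w) \<noteq> 0"
    then show "s = tail Qt x \<and> w \<noteq> [] \<and> t.awalk (tail Qt x) w (head Qt x)"
      using x by (rule old_shift_nonzero) (auto simp: t.awalk_simps partners arcs_premutation)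
  qed
  show "avoiding matched_old (old_shift x) = old_shift x"
    unfolding avoiding_eq_iff using x by (auto elim!: old_shift_nonzero)
qed

abbreviation "old_subst \<equiv> subst Qt Qt (shift_arrows Qt matched_old old_shift)"

text \<open>The projection removes the arrow itself from the image of a matched \<open>Old\<close>
  arrow. What remains is the monomial prescribed by the replacement that defines
  \<open>star_potential\<close>, sign included.\<close>

lemma avoiding_shift_old:
  "avoiding matched_old (shift_arrows Qt matched_old old_shift x) =
    single (tail Qt x, star_arrow x) (star_sign x)"
proof (cases "x \<in> matched_old")
  case True
  then obtain \<gamma> where \<gamma>: "x = Old \<gamma>" "\<gamma> \<in> G" by (auto simp: matched_old_def)
  then show ?thesis
    by (auto simp: fun_eq_iff avoiding_apply shift_arrows_def old_shift_def path_elem_def single_apply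
        star_arrow_def star_sign_def partners)
next
  case False
  moreover from False have "star_arrow x = [x]"
    by (auto simp: star_arrow_def matched_old_def split: mut_arrow.splits)
  ultimately show ?thesis
    by (auto simp: fun_eq_iff avoiding_apply shift_arrows_def path_elem_def single_apply star_sign_def)
qed

definition bracketed :: "('v, 'a mut_arrow, 'k) series" where
  "bracketed = bracket Q k S"

lemma bracketed_nonzero:
  assumes "bracketed (u, v) \<noteq> 0"
  obtains w where "S (u, w) \<noteq> 0" "v = bracket_word Q k w" "t.awalk u v u" "set v \<inter> matched_comp = {}"
proof -
  from assms obtain w where w: "S (u, w) \<noteq> 0" "v = bracket_word Q k w"
    unfolding bracketed_def bracket_relabel by (auto elim: relabel_nonzeroE)
  have "u \<noteq> k" using w(1) S_start by auto
  then have "t.awalk u v u" using S_closed[OF w(1)] w(2) by (auto intro: awalk_bracket_word)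
  moreover have "set v \<inter> matched_comp = {}"
    using S_avoids[OF w(1)] w(2) by (auto simp: matched_comp_def dest: Comp_in_bracket_word)
  ultimately show thesis using that w by blast
qed

definition shifted :: "('v, 'a mut_arrow, 'k) series" where
  "shifted = old_subst bracketed"

lemma shifted_closed:
  assumes "shifted (u, v) \<noteq> 0"
  shows "t.awalk u v u"
proof -
  interpret substitution Qt Qt "shift_arrows Qt matched_old old_shift" by (rule s.substitution)
  from assms obtain w where "bracketed (u, w) * subst_path Qt Qt (shift_arrows Qt matched_old old_shift) w u (u, v) \<noteq> 0"
    unfolding shifted_def subst_apply by (meson sum.neutral)
  then have w: "bracketed (u, w) \<noteq> 0"
    "subst_path Qt Qt (shift_arrows Qt matched_old old_shift) w u (u, v) \<noteq> 0" by auto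
  from w(1) have "t.awalk u w u" by (rule bracketed_nonzero)
  with subst_path_nonzero(4)[OF w(2)] show ?thesis by (simp add: path_end_eq)
qed

lemma shifted_avoids: "avoiding matched_comp shifted = shifted"
  unfolding shifted_def avoiding_subst
proof (rule subst_cong)
  fix u w a assume "bracketed (u, w) \<noteq> 0" "a \<in> set w"
  then have "a \<notin> matched_comp" by (auto elim: bracketed_nonzero)
  then show "avoiding matched_comp (shift_arrows Qt matched_old old_shift a) = shift_arrows Qt matched_old old_shift a"
    unfolding avoiding_eq_iff
    by (auto simp: shift_arrows_def path_elem_arrow_apply elim!: old_shift_nonzero split: if_splits)
qed

text \<open>The projection is moved onto the images of the arrows, which thereby become monomials;
  substituting monomials is letterwise rewriting of words, as in \<open>star_word\<close>.\<close>

lemma avoiding_shifted: "avoiding matched_old shifted = star_potential Q k P G m S"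
proof -
  let ?f = "\<lambda>x. single (tail Qt x, star_arrow x) (star_sign x) :: ('v, 'a mut_arrow, 'k) series"
  let ?F = "\<lambda>(u, w). single (u, concat (map star_arrow w)) (prod_list (map star_sign w) :: 'k)"
  \<comment> \<open>Projecting an admissible image keeps it admissible, so the monomials define a
    substitution of their own.\<close>
  have parallel: "parallel_series Qt (tail Qt x) (head Qt x) (?f x)" if "x \<in> arcs Qt" for x
    using substitution.arrow_image[OF s.substitution that]
    unfolding avoiding_shift_old[symmetric] by (auto simp: parallel_series_def avoiding_apply)
  interpret f: substitution Qt Qt ?f
    by unfold_locales (use parallel in auto)
  have "avoiding matched_old shifted = subst Qt Qt ?f bracketed"
    by (simp add: shifted_def avoiding_subst avoiding_shift_old)
  also have "\<dots> = series_extend ?F bracketed"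
  proof (rule f.subst_eq_series_extend)
    fix u w assume "bracketed (u, w) \<noteq> 0"
    then have w: "t.awalk u w u" by (auto elim: bracketed_nonzero)
    have "t.awalk (tail Qt x) (star_arrow x) (head Qt x)" if "x \<in> set w" for x
    proof -
      \<comment> \<open>The coefficient is \<open>1\<close> or \<open>- 1\<close>, so the endpoints
        of the word can be read off from \<open>parallel\<close>.\<close>
      have "?f x (tail Qt x, star_arrow x) \<noteq> 0" by (simp add: single_apply star_sign_def)
      moreover have "x \<in> arcs Qt" using w that by (auto simp: t.awalk_def)
      ultimately show ?thesis
        using parallel_seriesD(3)[OF parallel[of x]] by blast
    qed
    with w have "subst_path Qt Qt ?f w u = single (u, concat (map star_arrow w)) (prod_list (map star_sign w))"
      by (intro f.subst_path_monomial) (auto simp: paths_def)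
    then show "subst_path Qt Qt ?f w u = ?F (u, w)" by simp
  qed
  also have "\<dots> = star_potential Q k P G m S"
    unfolding bracketed_def bracket_relabel series_extend_relabel[OF inj_bracket] star_potential_def
  proof (rule series_extend_cong)
    fix p assume "S p \<noteq> 0"
    moreover obtain u w where p: "p = (u, w)" by (cases p)
    ultimately have "awalk u w u" "u \<noteq> k" using S_closed S_start by auto
    then show "?F (case p of (u, w) \<Rightarrow> (u, bracket_word Q k w)) =
        (case p of (u, w) \<Rightarrow> single (u, star_word Q k P G m w) ((- 1) ^ length (filter (\<lambda>a. a \<in> G) w)))"
      by (simp add: p star_word_eq prod_star_sign)
  qed
  finally show ?thesis .
qed

text \<open>Written over \<open>Qt\<close> rather than \<open>M\<close>: \<open>path_elem\<close>
  uses its quiver only through \<open>tail\<close>, on which the two agree.\<close>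

abbreviation "unmatched_sum \<equiv>
  (\<Sum>(\<alpha>, \<beta>)\<in>through Q k - P. path_elem Qt [Comp \<alpha> \<beta>, Star \<beta>, Star \<alpha>]) :: ('v, 'a mut_arrow, 'k) series"

lemma unmatched_sum_nonzero:
  assumes "unmatched_sum (u, w) \<noteq> 0"
  obtains \<alpha> \<beta> where "(\<alpha>, \<beta>) \<in> through Q k - P" "u = tail Q \<alpha>" "w = [Comp \<alpha> \<beta>, Star \<beta>, Star \<alpha>]"
proof -
  from assms obtain c where "c \<in> through Q k - P"
      "(case c of (\<alpha>, \<beta>) \<Rightarrow> path_elem Qt [Comp \<alpha> \<beta>, Star \<beta>, Star \<alpha>] (u, w)) \<noteq> (0 :: 'k)"
    by (auto simp: sum_fun_apply case_prod_unfold elim: sum.not_neutral_contains_not_neutral)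
  with that show thesis by (cases c) (auto simp: path_elem_def single_apply split: if_splits)
qed

lemma awalk_triangle:
  assumes "(\<alpha>, \<beta>) \<in> through Q k"
  shows "t.awalk (tail Q \<alpha>) [Comp \<alpha> \<beta>, Star \<beta>, Star \<alpha>] (tail Q \<alpha>)"
  using assms by (auto simp: t.awalk_simps arcs_premutation through_def)

lemma unmatched_sum_carrier: "unmatched_sum \<in> carrier (complete_path_algebra Qt)"
  using awalk_triangle by (auto simp: carrier_iff paths_def elim!: unmatched_sum_nonzero)

lemma unmatched_sum_avoids:
  "avoiding matched_old unmatched_sum = unmatched_sum" "avoiding matched_comp unmatched_sum = unmatched_sum"
  by (auto simp: avoiding_eq_iff elim!: unmatched_sum_nonzero)

lemma premutation_potential:
  "snd (premutation k (Q, (\<Sum>\<gamma>\<in>G. path_elem Q [pin \<gamma>, pout \<gamma>, \<gamma>]) + S)) =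
    unmatched_sum + (\<Sum>\<gamma>\<in>G. series_mult Qt (path_elem Qt [Comp (pin \<gamma>) (pout \<gamma>)])
      (path_elem Qt [Old \<gamma>] + path_elem Qt [Star (pout \<gamma>), Star (pin \<gamma>)])) + bracketed"
proof -
  let ?c = "\<lambda>\<alpha> \<beta>. path_elem Qt [Comp \<alpha> \<beta>, Star \<beta>, Star \<alpha>] :: ('v, 'a mut_arrow, 'k) series"
  have "(\<Sum>(\<alpha>, \<beta>)\<in>P. ?c \<alpha> \<beta>) = (\<Sum>\<gamma>\<in>G. ?c (pin \<gamma>) (pout \<gamma>))"
    using sum.reindex_bij_betw[OF bij_partners, of "\<lambda>(\<alpha>, \<beta>). ?c \<alpha> \<beta>"] by simp
  then have through: "(\<Sum>(\<alpha>, \<beta>)\<in>through Q k. ?c \<alpha> \<beta>) = unmatched_sum + (\<Sum>\<gamma>\<in>G. ?c (pin \<gamma>) (pout \<gamma>))"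
    using sum.subset_diff[OF P_through finite_through, of "\<lambda>(\<alpha>, \<beta>). ?c \<alpha> \<beta>"] by simp
  have "bracket Q k (path_elem Q [pin \<gamma>, pout \<gamma>, \<gamma>]) =
      (path_elem Qt [Comp (pin \<gamma>) (pout \<gamma>), Old \<gamma>] :: ('v, 'a mut_arrow, 'k) series)"
    if "\<gamma> \<in> G" for \<gamma>
    using that unfolding bracket_relabel path_elem_def relabel_single[OF inj_bracket] by (simp add: partners)
  then have "bracket Q k ((\<Sum>\<gamma>\<in>G. path_elem Q [pin \<gamma>, pout \<gamma>, \<gamma>]) + S) =
      (\<Sum>\<gamma>\<in>G. path_elem Qt [Comp (pin \<gamma>) (pout \<gamma>), Old \<gamma>]) + bracketed"
    unfolding bracketed_def bracket_relabel relabel_add[OF inj_bracket] relabel_sum[OF inj_bracket]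
    by simp
  moreover have "series_mult Qt (path_elem Qt [Comp (pin \<gamma>) (pout \<gamma>)])
      (path_elem Qt [Old \<gamma>] + path_elem Qt [Star (pout \<gamma>), Star (pin \<gamma>)]) =
      path_elem Qt [Comp (pin \<gamma>) (pout \<gamma>), Old \<gamma>] + ?c (pin \<gamma>) (pout \<gamma>)" if "\<gamma> \<in> G" for \<gamma>
    using that by (simp add: series_mult_add_right path_elem_append partners)
  ultimately show ?thesis
    by (simp add: through sum.distrib add_ac cong: sum.cong)
qed

text \<open>Rotation is not an algebra map, so \<open>R\<close> serves only to define the second
  shift, and both automorphisms act on the unrotated potential. As the second fixes
  \<open>shifted\<close>, the result differs from the target by exactly \<open>shifted - R\<close>;
  this is the only place where a cyclic equivalence is used.\<close>

lemma premutation_right_equivalent: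
  obtains \<Phi> where "path_algebra_iso Qt Qt \<Phi>"
    and "cyclically_equivalent Qt
      (\<Phi> (snd (premutation k (Q, (\<Sum>\<gamma>\<in>G. path_elem Q [pin \<gamma>, pout \<gamma>, \<gamma>]) + S))))
      (unmatched_sum + star_potential Q k P G m S + (\<Sum>\<gamma>\<in>G. path_elem Qt [Comp (pin \<gamma>) (pout \<gamma>), Old \<gamma>]))"
proof -
  obtain R where R: "cyclically_equivalent Qt shifted R"
      "\<And>u w. R (u, w) \<noteq> 0 \<Longrightarrow> t.awalk u w u"
      "\<And>u w. R (u, w) \<noteq> 0 \<Longrightarrow> set w \<inter> matched_old \<noteq> {} \<Longrightarrow> last w \<in> matched_old"
      "\<And>u w. R (u, w) \<noteq> 0 \<Longrightarrow> \<exists>u' w'. shifted (u', w') \<noteq> 0 \<and> set w' = set w"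
      "\<And>u w. set w \<inter> matched_old = {} \<Longrightarrow> R (u, w) = shifted (u, w)"
    by (rule t.rotate_to_end[where Z = shifted and X = matched_old, OF shifted_closed]) blast+
  let ?x = "\<lambda>\<gamma>. path_elem Qt [Comp (pin \<gamma>) (pout \<gamma>)] :: ('v, 'a mut_arrow, 'k) series"
  let ?y = "\<lambda>\<gamma>. path_elem Qt [Old \<gamma>] :: ('v, 'a mut_arrow, 'k) series"
  let ?s = "\<lambda>\<gamma>. path_elem Qt [Star (pout \<gamma>), Star (pin \<gamma>)] :: ('v, 'a mut_arrow, 'k) series"
  \<comment> \<open>The terms of \<open>R\<close> ending in \<open>Old \<gamma>\<close>, with this
    last arrow stripped off.\<close>
  define c where "c \<gamma> = (\<lambda>(u, w). R (u, w @ [Old \<gamma>]))" for \<gamma>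
  \<comment> \<open>\<open>m\<close> leads from the composite arrow to its \<open>\<gamma>\<close>.
    The sign makes the product with \<open>Old \<gamma>\<close> cancel the terms of \<open>R\<close>
    that end in it.\<close>
  define comp_shift where "comp_shift x = (case x of Comp \<alpha> \<beta> \<Rightarrow> - c (m (\<alpha>, \<beta>)) | _ \<Rightarrow> 0)" for x
  have R_avoids: "set w \<inter> matched_comp = {}" if "R (u, w) \<noteq> 0" for u w
    using R(4)[OF that] shifted_avoids unfolding avoiding_eq_iff by metis
  interpret s2: arrow_shift Qt matched_comp comp_shift
  proof unfold_locales
    fix x assume "x \<in> matched_comp"
    then obtain \<alpha> \<beta> where x: "x = Comp \<alpha> \<beta>" "(\<alpha>, \<beta>) \<in> P" by (auto simp: matched_comp_def)
    let ?\<gamma> = "m (\<alpha>, \<beta>)"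
    have \<gamma>: "?\<gamma> \<in> G" "tail Q ?\<gamma> = head Q \<beta>" "head Q ?\<gamma> = tail Q \<alpha>"
      using partners_m(1)[OF x(2)] m_ends[OF x(2)] by auto
    have nonzero: "R (s, w @ [Old ?\<gamma>]) \<noteq> 0" if "comp_shift x (s, w) \<noteq> 0" for s w
      using that by (auto simp: comp_shift_def c_def x)
    show "avoiding matched_comp (comp_shift x) = comp_shift x"
      unfolding avoiding_eq_iff using R_avoids nonzero by fastforce
    show "parallel_series Qt (tail Qt x) (head Qt x) (comp_shift x)"
      unfolding parallel_series_def
    proof (intro allI impI)
      fix s w assume "comp_shift x (s, w) \<noteq> 0"
      from R(2)[OF nonzero[OF this]] have "t.awalk s w (tail Q ?\<gamma>)" "s = head Q ?\<gamma>"
        by (auto simp: t.awalk_simps)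
      \<comment> \<open>A lazy term in the correction would come from the closed path consisting of
        \<open>Old ?\<gamma>\<close> alone, that is, from a loop.\<close>
      moreover have "tail Q ?\<gamma> \<noteq> head Q ?\<gamma>" using no_loops G_arcs[OF \<gamma>(1)] by auto
      ultimately show "s = tail Qt x \<and> w \<noteq> [] \<and> t.awalk (tail Qt x) w (head Qt x)"
        using \<gamma> x by (auto simp: t.awalk_simps)
    qed
  qed
  let ?comp_subst = "subst Qt Qt (shift_arrows Qt matched_comp comp_shift)"
  interpret f1: substitution Qt Qt "shift_arrows Qt matched_old old_shift" by (rule s.substitution)
  interpret f2: substitution Qt Qt "shift_arrows Qt matched_comp comp_shift" by (rule s2.substitution)
  have arcs: "Comp (pin \<gamma>) (pout \<gamma>) \<in> arcs Qt" "Old \<gamma> \<in> arcs Qt" if "\<gamma> \<in> G" for \<gamma>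
    using matched_subset that partners(1)[OF that] by (auto simp: subset_iff)
  have pair: "?comp_subst (old_subst (series_mult Qt (?x \<gamma>) (?y \<gamma> + ?s \<gamma>))) =
      path_elem Qt [Comp (pin \<gamma>) (pout \<gamma>), Old \<gamma>] - series_mult Qt (c \<gamma>) (?y \<gamma>)" if \<gamma>: "\<gamma> \<in> G" for \<gamma>
  proof -
    have "?s \<gamma> \<in> carrier (complete_path_algebra Qt)"
      using \<gamma> by (auto simp: carrier_iff path_elem_def single_apply paths_def t.awalk_simps arcs_premutation
          partners split: if_splits)
    moreover have "avoiding matched_old (?s \<gamma>) = ?s \<gamma>"
      by (auto simp: avoiding_eq_iff path_elem_def single_apply split: if_splits)
    ultimately have "old_subst (?s \<gamma>) = ?s \<gamma>" by (rule s.subst_fixes)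
    moreover have "old_subst (?y \<gamma>) = ?y \<gamma> - ?s \<gamma>" "old_subst (?x \<gamma>) = ?x \<gamma>"
      using \<gamma> by (simp_all add: f1.subst_arrow[OF arcs(1)] f1.subst_arrow[OF arcs(2)] shift_arrows_def old_shift_def)
    ultimately have "old_subst (series_mult Qt (?x \<gamma>) (?y \<gamma> + ?s \<gamma>)) = series_mult Qt (?x \<gamma>) (?y \<gamma>)"
      by (simp add: f1.subst_mult subst_add)
    moreover have "?comp_subst (?y \<gamma>) = ?y \<gamma>" "?comp_subst (?x \<gamma>) = ?x \<gamma> - c \<gamma>"
      using \<gamma> by (simp_all add: f2.subst_arrow[OF arcs(1)] f2.subst_arrow[OF arcs(2)] shift_arrows_def
          comp_shift_def partners)
    ultimately have "?comp_subst (old_subst (series_mult Qt (?x \<gamma>) (?y \<gamma> + ?s \<gamma>))) =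
        series_mult Qt (?x \<gamma>) (?y \<gamma>) - series_mult Qt (c \<gamma>) (?y \<gamma>)"
      by (simp only: f2.subst_mult series_mult_diff_left)
    also have "series_mult Qt (?x \<gamma>) (?y \<gamma>) = path_elem Qt [Comp (pin \<gamma>) (pout \<gamma>), Old \<gamma>]"
      using \<gamma> by (simp add: path_elem_append partners)
    finally show ?thesis .
  qed
  have shifted_fixed: "?comp_subst shifted = shifted"
    using shifted_closed shifted_avoids by (intro s2.subst_fixes) (auto simp: carrier_iff paths_def)
  have unmatched_fixed: "?comp_subst (old_subst unmatched_sum) = unmatched_sum"
    by (simp only: s.subst_fixes[OF unmatched_sum_carrier unmatched_sum_avoids(1)]
        s2.subst_fixes[OF unmatched_sum_carrier unmatched_sum_avoids(2)])
  let ?W = "snd (premutation k (Q, (\<Sum>\<gamma>\<in>G. path_elem Q [pin \<gamma>, pout \<gamma>, \<gamma>]) + S))"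
  let ?xy = "\<Sum>\<gamma>\<in>G. path_elem Qt [Comp (pin \<gamma>) (pout \<gamma>), Old \<gamma>] :: ('v, 'a mut_arrow, 'k) series"
  let ?cy = "\<Sum>\<gamma>\<in>G. series_mult Qt (c \<gamma>) (?y \<gamma>)"
  have "?comp_subst (old_subst ?W) = unmatched_sum + (?xy - ?cy) + shifted"
    unfolding premutation_potential subst_add shifted_def[symmetric] unmatched_fixed shifted_fixed
    unfolding subst_sum by (simp add: pair sum_subtractf cong: sum.cong)
  \<comment> \<open>Terms of \<open>R\<close> without matched \<open>Old\<close> arrows are those of
    \<open>shifted\<close>, as they were not rotated; all others end in some
    \<open>Old \<gamma>\<close>.\<close>
  moreover have "R = star_potential Q k P G m S + ?cy"
  proof -
    have "R = avoiding matched_old R +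
        (\<Sum>a\<in>matched_old. series_mult Qt (\<lambda>(u, w). R (u, w @ [a])) (path_elem Qt [a]))"
      using R(2,3) by (intro t.split_last_arrow finite_matched matched_subset) (auto simp: paths_def)
    also have "avoiding matched_old R = avoiding matched_old shifted"
      using R(5) by (auto simp: fun_eq_iff avoiding_apply)
    also have "(\<Sum>a\<in>matched_old. series_mult Qt (\<lambda>(u, w). R (u, w @ [a])) (path_elem Qt [a])) = ?cy"
      unfolding matched_old_def c_def by (subst sum.reindex) (auto simp: inj_on_def)
    finally show ?thesis by (simp only: avoiding_shifted)
  qed
  ultimately have "?comp_subst (old_subst ?W) - (unmatched_sum + star_potential Q k P G m S + ?xy) = shifted - R"
    by (simp add: algebra_simps)
  then have "cyclically_equivalent Qt ((?comp_subst \<circ> old_subst) ?W)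
      (unmatched_sum + star_potential Q k P G m S + ?xy)"
    using R(1) by (simp only: cyclically_equivalent_def o_apply)
  moreover have "path_algebra_iso Qt Qt (?comp_subst \<circ> old_subst)"
    by (rule path_algebra_iso_comp[OF s.iso s2.iso refl])
  ultimately show thesis using that by blast
qed

end

section \<open>Reducedness of the remaining potential\<close>

lemma sum_path_elem_nonzeroE:
  assumes "(\<Sum>i\<in>I. path_elem Q (w i)) (u, v) \<noteq> (0 :: 'k::field)"
  obtains i where "i \<in> I" "u = tail Q (hd (w i))" "v = w i"
proof -
  from assms obtain i where "i \<in> I" "path_elem Q (w i) (u, v) \<noteq> (0 :: 'k)"
    unfolding sum_fun_apply by (rule sum.not_neutral_contains_not_neutral)
  with that show thesis by (auto simp: path_elem_def single_apply split: if_splits)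
qed

lemma (in fin_digraph) no_short_cycle:
  assumes "loopfree_digraph G" "no_two_cycles G" "awalk u w u" "2 \<le> length w"
  shows "3 \<le> length w"
proof (rule ccontr)
  assume "\<not> 3 \<le> length w"
  with assms(4) have "length w = 2" by simp
  then obtain a b where "w = [a, b]" by (auto simp: length_Suc_conv numeral_2_eq_2)
  with assms(3) have "a \<in> arcs G" "b \<in> arcs G" "head G a = tail G b" "head G b = tail G a"
    by (auto simp: awalk_simps)
  \<comment> \<open>\<open>no_two_cycles\<close> concerns distinct arrows; for \<open>a = b\<close>
    the path would be a loop traversed twice.\<close>
  with assms(2) loopfree_digraph.no_loops[OF assms(1), of a] show False
    unfolding no_two_cycles_def by metis
qed

context matched_potential
begin

lemma star_potential_nonzero:
  assumes "star_potential Q k P G m S (u, v) \<noteq> 0"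
  obtains w where "S (u, w) \<noteq> 0" "v = concat (map star_arrow (bracket_word Q k w))"
    and "pre_digraph.awalk M u v u"
proof -
  from assms obtain w where w: "S (u, w) \<noteq> 0" "v = concat (map star_arrow (bracket_word Q k w))"
    unfolding star_potential_def
    by (rule series_extend_nonzeroE) (auto simp: single_apply star_word_eq split: if_splits)
  from assms have "shifted (u, v) \<noteq> 0" "set v \<inter> matched_old = {}"
    unfolding avoiding_shifted[symmetric] by (auto simp: avoiding_apply split: if_splits)
  with shifted_avoids have "pre_digraph.awalk M u v u"
    unfolding awalk_mutation_iff avoiding_eq_iff by (auto dest: shifted_closed)
  with w that show thesis by blast
qed

text \<open>\<open>star_arrow\<close> never shortens a word, so the critical case is a bracketed
  word of two letters. Two \<open>Old\<close> letters would be a 2-cycle of \<open>Q\<close>; two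
  composites would have inner arrows forming one. A composite next to an \<open>Old\<close> arrow
  belongs to an unmatched pair, so maximality puts that arrow into \<open>G\<close>, and it is
  replaced by two letters.\<close>

lemma star_potential_length:
  assumes "star_potential Q k P G m S (u, v) \<noteq> 0"
  shows "3 \<le> length v"
proof -
  from assms obtain w where S: "S (u, w) \<noteq> 0" and v: "v = concat (map star_arrow (bracket_word Q k w))"
    by (rule star_potential_nonzero)
  let ?b = "bracket_word Q k w"
  have walk: "awalk u w u" and w3: "3 \<le> length w"
    using S_closed[OF S] no_short_cycle[OF loopfree_digraph_axioms no_two_cycles] by auto
  have w: "w = concat (map unbracket_arrow ?b)" by (simp add: unbracket_word)
  have "bracketed (u, ?b) \<noteq> 0"
    using S relabel_apply[OF inj_bracket[where Q = Q and k = k], of S "(u, w)"] by (simp add: bracketed_def bracket_relabel)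
  then have b: "t.awalk u ?b u" "set ?b \<inter> matched_comp = {}"
    by (auto elim: bracketed_nonzero)
  have star: "length x \<le> length (concat (map star_arrow x))" for x
    by (induction x) (auto simp: star_arrow_def split: mut_arrow.splits)
  consider "?b = []" | x where "?b = [x]" | x y where "?b = [x, y]" | "3 \<le> length ?b"
    by (cases ?b; cases "tl ?b"; cases "tl (tl ?b)") auto
  then show ?thesis
  proof cases
    case 1
    with w w3 show ?thesis by simp
  next
    case (2 x)
    have "length (unbracket_arrow x) \<le> 2" by (cases x) auto
    moreover have "w = unbracket_arrow x" using w 2 by simp
    ultimately show ?thesis using w3 by simp
  next
    case (3 x y)
    have stars: "x \<noteq> Star a" "y \<noteq> Star a" for a
      using Star_notin_bracket_word[of a Q k w] 3 by auto
    have unmatched: "c \<in> G" if "(\<alpha>, \<beta>) \<in> through Q k" "(\<alpha>, \<beta>) \<notin> P" "c \<in> arcs Q"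
        "tail Q c = head Q \<beta>" "head Q c = tail Q \<alpha>" for \<alpha> \<beta> c
      using maximal that by blast
    show ?thesis
    proof (cases x)
      case (Old a)
      then show ?thesis
      proof (cases y)
        case y: (Old a')
        with Old 3 w w3 show ?thesis by simp
      next
        case y: (Comp \<alpha> \<beta>)
        with Old 3 b have "a \<in> G"
          by (intro unmatched[of \<alpha> \<beta>]) (auto simp: t.awalk_simps arcs_premutation)
        with Old y 3 v show ?thesis by (simp add: star_arrow_def)
      qed (use stars in auto)
    next
      case (Comp \<alpha> \<beta>)
      then show ?thesis
      proof (cases y)
        case y: (Old a)
        with Comp 3 b have "a \<in> G"
          by (intro unmatched[of \<alpha> \<beta>]) (auto simp: t.awalk_simps arcs_premutation)
        with Comp y 3 v show ?thesis by (simp add: star_arrow_def)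
      next
        case y: (Comp \<gamma> \<delta>)
        with Comp 3 b have "\<beta> \<in> arcs Q" "\<gamma> \<in> arcs Q" "tail Q \<beta> = k" "head Q \<gamma> = k" "head Q \<beta> = tail Q \<gamma>"
          by (auto simp: t.awalk_simps arcs_premutation through_def)
        with no_two_cycles no_loops[of \<beta>] show ?thesis
          unfolding no_two_cycles_def by metis
      qed (use stars in auto)
    qed (use stars in auto)
  next
    case 4
    with star[of ?b] v show ?thesis by simp
  qed
qed

abbreviation "W_red \<equiv> unmatched_sum + star_potential Q k P G m S"

lemma W_red_nonzero:
  assumes "W_red (u, v) \<noteq> 0"
  shows "pre_digraph.awalk M u v u" "3 \<le> length v"
proof -
  from assms have "unmatched_sum (u, v) \<noteq> 0 \<or> star_potential Q k P G m S (u, v) \<noteq> 0" by auto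
  then have "pre_digraph.awalk M u v u \<and> 3 \<le> length v"
  proof
    assume "unmatched_sum (u, v) \<noteq> 0"
    then show ?thesis
      by (rule unmatched_sum_nonzero) (auto simp: awalk_mutation_iff awalk_triangle)
  next
    assume "star_potential Q k P G m S (u, v) \<noteq> 0"
    then show ?thesis using star_potential_length by (auto elim: star_potential_nonzero)
  qed
  then show "pre_digraph.awalk M u v u" "3 \<le> length v" by auto
qed

lemma reduced: "reduced_qp (M, W_red)"
  using W_red_nonzero fin_digraph_mutation
  by (fastforce simp: potential_def cycles_of_length_ge_def simp del: plus_fun_apply)

lemma W_red_carrier: "W_red \<in> carrier (complete_path_algebra Qt)"
  using W_red_nonzero(1) by (auto simp: carrier_iff paths_def awalk_mutation_iff simp del: plus_fun_apply)

text \<open>The direct sum has tagged arrows, and those of its trivial summand are natural numbers.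
  The splitting is already present in \<open>Qt\<close> after \<open>\<Phi>\<close>; only a
  relabelling \<open>\<rho>\<close> onto the sum remains.\<close>

lemma is_reduced_part_premutation:
  "is_reduced_part (premutation k (Q, (\<Sum>\<gamma>\<in>G. path_elem Q [pin \<gamma>, pout \<gamma>, \<gamma>]) + S)) (M, W_red)"
proof -
  define n where "n = card G"
  obtain e where e: "bij_betw e {..<n} G"
    using ex_bij_betw_nat_finite[OF finite_G] by (auto simp: n_def lessThan_atLeast0)
  define d where "d = inv_into {..<n} e"
  have d: "d (e r) = r" "e r \<in> G" if "r < n" for r
    using e that by (auto simp: d_def bij_betw_def)
  have d': "d \<gamma> < n" "e (d \<gamma>) = \<gamma>" if "\<gamma> \<in> G" for \<gamma>
    using e that inv_into_into[of \<gamma> e "{..<n}"] by (auto simp: d_def bij_betw_def f_inv_into_f)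
  \<comment> \<open>Numbers below \<open>n\<close> name matched composites, those from
    \<open>n\<close> on matched arrows of \<open>Q\<close>, so that \<open>r\<close> and
    \<open>n + r\<close> form a 2-cycle.\<close>
  define \<tau> where "\<tau> r = (if r < n then Comp (pin (e r)) (pout (e r)) else Old (e (r - n)))" for r
  \<comment> \<open>Inverse of \<open>\<tau>\<close> on the matched arrows; the value at
    \<open>Star\<close> is a dummy.\<close>
  define \<iota> where "\<iota> x = (case x of Comp \<alpha> \<beta> \<Rightarrow> d (m (\<alpha>, \<beta>)) | Old \<gamma> \<Rightarrow> n + d \<gamma> | Star _ \<Rightarrow> 0)" for x
  define T :: "('v, nat) pre_digraph" where
    "T = \<lparr>verts = verts Q, arcs = {..<n + n}, tail = (\<lambda>r. tail Qt (\<tau> r)), head = (\<lambda>r. head Qt (\<tau> r))\<rparr>"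
  define W_triv :: "('v, nat, 'k) series" where "W_triv = (\<Sum>r<n. path_elem T [r, n + r])"
  define D where "D = fst (direct_sum_qp (M, W_red) (T, W_triv))"
  have \<tau>: "\<tau> r \<in> matched_old \<union> matched_comp" "\<iota> (\<tau> r) = r" if "r < n + n" for r
    using that d partners(1,2) by (auto simp: \<tau>_def \<iota>_def)
  have \<iota>: "\<iota> x < n + n" "\<tau> (\<iota> x) = x" if "x \<in> matched_old \<union> matched_comp" for x
    using that d' partners_m by (auto simp: \<tau>_def \<iota>_def matched_old_def matched_comp_def trans_less_add1)
  have T_simps: "verts T = verts Q" "arcs T = {..<n + n}" "tail T r = tail Qt (\<tau> r)" "head T r = head Qt (\<tau> r)" for r
    by (simp_all add: T_def)
  have T_arcs: "\<tau> r \<in> arcs Qt" if "r < n + n" for r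
    using \<tau>(1)[OF that] matched_subset by auto
  interpret T: fin_digraph T
    by unfold_locales (use T_arcs t.tail_in_verts t.head_in_verts in \<open>auto simp: T_simps\<close>)
  have D_simps: "verts D = verts Q" "arcs D = arcs M <+> {..<n + n}"
    "tail D (Inl x) = tail Qt x" "tail D (Inr r) = tail Qt (\<tau> r)"
    "head D (Inl x) = head Qt x" "head D (Inr r) = head Qt (\<tau> r)" for x r
    by (simp_all add: D_def T_simps)
  interpret M: fin_digraph M by (rule fin_digraph_mutation)
  interpret D: fin_digraph D
    by unfold_locales (use T.tail_in_verts T.head_in_verts M.tail_in_verts M.head_in_verts in
        \<open>auto simp: D_simps T_simps\<close>)
  have pair_ends: "head Qt (\<tau> r) = tail Qt (\<tau> (n + r))" "head Qt (\<tau> (n + r)) = tail Qt (\<tau> r)" if "r < n" for r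
    using d(2)[OF that] by (simp_all add: \<tau>_def that partners)
  define \<rho> where "\<rho> x = (if x \<in> matched_old \<union> matched_comp then Inr (\<iota> x) else Inl x)" for x
  interpret relabelling Qt D \<rho> "case_sum (\<lambda>x. x) \<tau>"
  proof unfold_locales
    fix x assume "x \<in> arcs Qt"
    then show "\<rho> x \<in> arcs D \<and> (case \<rho> x of Inl x \<Rightarrow> x | Inr r \<Rightarrow> \<tau> r) = x \<and>
        tail D (\<rho> x) = tail Qt x \<and> head D (\<rho> x) = head Qt x"
      using \<iota>[of x] by (auto simp: \<rho>_def D_simps arcs_mutation)
  next
    fix y assume "y \<in> arcs D"
    then show "(case y of Inl x \<Rightarrow> x | Inr r \<Rightarrow> \<tau> r) \<in> arcs Qt \<and> \<rho> (case y of Inl x \<Rightarrow> x | Inr r \<Rightarrow> \<tau> r) = y"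
      using \<tau> T_arcs by (auto simp: \<rho>_def D_simps arcs_mutation) blast
  qed (simp add: D_simps)
  interpret \<rho>: substitution Qt D "\<lambda>a. path_elem D [\<rho> a]" by (rule substitution)
  let ?\<rho> = "subst Qt D (\<lambda>a. path_elem D [\<rho> a]) :: ('v, 'a mut_arrow, 'k) series \<Rightarrow> _"
  let ?xy = "\<Sum>\<gamma>\<in>G. path_elem Qt [Comp (pin \<gamma>) (pout \<gamma>), Old \<gamma>] :: ('v, 'a mut_arrow, 'k) series"

  \<comment> \<open>No term of \<open>W_red\<close> contains a matched arrow, so
    \<open>\<rho>\<close> acts as \<open>Inl\<close> on every letter.\<close>
  have "?\<rho> W_red = map_arrows Inl W_red"
    unfolding subst_eq_map_arrows[OF W_red_carrier] map_arrows_def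
  proof (rule series_extend_cong)
    fix p assume "W_red p \<noteq> 0"
    moreover obtain u w where p: "p = (u, w)" by (cases p)
    ultimately have "set w \<inter> matched_old = {}" "set w \<inter> matched_comp = {}"
      using W_red_nonzero(1)[of u w] by (auto simp: awalk_mutation_iff)
    then have "map \<rho> w = map Inl w" by (auto simp: \<rho>_def)
    then show "(case p of (u, w) \<Rightarrow> single (u, map \<rho> w) 1) = (case p of (u, w) \<Rightarrow> single (u, map Inl w) (1 :: 'k))"
      by (simp only: p prod.case)
  qed
  moreover have "?\<rho> ?xy = map_arrows Inr W_triv"
  proof -
    have inj: "inj (\<lambda>(u, w). (u, map Inr w))" by (auto simp: inj_def inj_map_eq_map)
    have xy: "?xy = (\<Sum>r<n. path_elem Qt [\<tau> r, \<tau> (n + r)])"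
      unfolding sum.reindex_bij_betw[OF e, symmetric] by (rule sum.cong) (auto simp: \<tau>_def)
    have "?\<rho> ?xy = (\<Sum>r<n. path_elem D [Inr r, Inr (n + r)])"
      unfolding xy subst_sum
    proof (rule sum.cong[OF refl])
      fix r assume "r \<in> {..<n}"
      then have r: "r < n" by simp
      have a: "\<tau> r \<in> arcs Qt" "\<tau> (n + r) \<in> arcs Qt" using r by (auto intro: T_arcs)
      have split: "path_elem Qt [\<tau> r, \<tau> (n + r)] =
          (series_mult Qt (path_elem Qt [\<tau> r]) (path_elem Qt [\<tau> (n + r)]) :: ('v, 'a mut_arrow, 'k) series)"
        using pair_ends[OF r] by (simp add: path_elem_append)
      have "?\<rho> (path_elem Qt [\<tau> r, \<tau> (n + r)]) =
          series_mult D (path_elem D [\<rho> (\<tau> r)]) (path_elem D [\<rho> (\<tau> (n + r))])"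
        unfolding split by (simp only: \<rho>.subst_mult \<rho>.subst_arrow a)
      moreover have "\<rho> (\<tau> r) = Inr r" "\<rho> (\<tau> (n + r)) = Inr (n + r)"
        using r \<tau>[of r] \<tau>[of "n + r"] by (auto simp: \<rho>_def)
      ultimately show "?\<rho> (path_elem Qt [\<tau> r, \<tau> (n + r)]) = path_elem D [Inr r, Inr (n + r)]"
        using pair_ends[OF r] by (simp add: path_elem_append D_simps)
    qed
    also have "\<dots> = map_arrows Inr W_triv"
      unfolding W_triv_def map_arrows_relabel relabel_sum[OF inj] path_elem_def relabel_single[OF inj]
      by (simp add: D_simps T_simps)
    finally show ?thesis .
  qed
  ultimately have target: "?\<rho> (W_red + ?xy) = map_arrows Inl W_red + map_arrows Inr W_triv"
    by (simp only: subst_add)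
  obtain \<Phi> where \<Phi>: "path_algebra_iso Qt Qt \<Phi>"
    "cyclically_equivalent Qt
      (\<Phi> (snd (premutation k (Q, (\<Sum>\<gamma>\<in>G. path_elem Q [pin \<gamma>, pout \<gamma>, \<gamma>]) + S)))) (W_red + ?xy)"
    by (rule premutation_right_equivalent)
  have right: "right_equivalent (premutation k (Q, (\<Sum>\<gamma>\<in>G. path_elem Q [pin \<gamma>, pout \<gamma>, \<gamma>]) + S))
      (direct_sum_qp (M, W_red) (T, W_triv))"
  proof -
    have D: "direct_sum_qp (M, W_red) (T, W_triv) = (D, map_arrows Inl W_red + map_arrows Inr W_triv)"
      by (simp add: D_def)
    have pre: "premutation k (Q, (\<Sum>\<gamma>\<in>G. path_elem Q [pin \<gamma>, pout \<gamma>, \<gamma>]) + S) =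
        (Qt, snd (premutation k (Q, (\<Sum>\<gamma>\<in>G. path_elem Q [pin \<gamma>, pout \<gamma>, \<gamma>]) + S)))"
      by simp
    have "path_algebra_iso Qt D (?\<rho> \<circ> \<Phi>)"
      by (rule path_algebra_iso_comp[OF \<Phi>(1) iso refl])
    moreover have "cyclically_equivalent D ((?\<rho> \<circ> \<Phi>) (snd (premutation k (Q, (\<Sum>\<gamma>\<in>G. path_elem Q [pin \<gamma>, pout \<gamma>, \<gamma>]) + S))))
        (map_arrows Inl W_red + map_arrows Inr W_triv)"
      using \<rho>.cyclically_equivalent_subst[OF \<Phi>(2)] by (simp only: target o_apply)
    ultimately have "right_equivalent
        (Qt, snd (premutation k (Q, (\<Sum>\<gamma>\<in>G. path_elem Q [pin \<gamma>, pout \<gamma>, \<gamma>]) + S)))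
        (D, map_arrows Inl W_red + map_arrows Inr W_triv)"
      unfolding right_equivalent.simps D_simps(1) premutation_simps(1) by blast
    then show ?thesis unfolding D by (subst pre)
  qed
  have "trivial_qp (T, W_triv)"
  proof -
    have pot: "potential T W_triv"
      unfolding potential_def
    proof (intro allI impI)
      fix p assume "W_triv p \<noteq> 0"
      then obtain r where r: "r < n" "p = (tail T r, [r, n + r])"
        unfolding W_triv_def by (cases p) (auto elim!: sum_path_elem_nonzeroE)
      with pair_ends[OF r(1)] T_arcs[of r] T_arcs[of "n + r"] t.tail_in_verts[OF T_arcs, of r] show "p \<in> cycles_of_length_ge T 2"
        by (auto simp: cycles_of_length_ge_def T.awalk_simps T_simps)
    qed
    have loopfree: "loopfree_digraph T"
    proof unfold_locales
      fix r assume "r \<in> arcs T"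
      then have "\<tau> r \<in> matched_old \<union> matched_comp" using \<tau> by (simp add: T_simps)
      then consider \<gamma> where "\<gamma> \<in> G" "\<tau> r = Old \<gamma>" | \<alpha> \<beta> where "(\<alpha>, \<beta>) \<in> P" "\<tau> r = Comp \<alpha> \<beta>"
        by (auto simp: matched_old_def matched_comp_def)
      then show "tail T r \<noteq> head T r"
      proof cases
        case 1
        with no_loops[of \<gamma>] G_arcs show ?thesis by (auto simp: T_simps)
      next
        case 2
        \<comment> \<open>A composite runs opposite to its matched arrow, so a loop would make that
          arrow a loop of \<open>Q\<close>.\<close>
        from partners_m(1)[OF 2(1)] m_ends[OF 2(1)] no_loops[of "m (\<alpha>, \<beta>)"] G_arcs 2(2)
        show ?thesis by (fastforce simp: T_simps)
      qed
    qed
    \<comment> \<open>\<open>W_triv\<close> already is the standard sum of 2-cycles, so the identity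
      serves as the linear automorphism.\<close>
    have id_iso: "path_algebra_iso T T (id :: ('v, nat, 'k) series \<Rightarrow> _)"
      by (simp add: path_algebra_iso_def ring_iso_set_refl)
    have split: "{..<n + n} = (\<lambda>r. r) ` {..<n} \<union> (\<lambda>r. n + r) ` {..<n}"
      using image_add_atLeastLessThan[of n 0 n] by (auto simp: lessThan_atLeast0)
    show ?thesis
      unfolding trivial_qp.simps is_qp.simps
      by (intro conjI;
          (rule exI[of _ n], rule exI[of _ "\<lambda>r. r"], rule exI[of _ "\<lambda>r. n + r"], rule exI[of _ id])?)
        (auto simp: T.fin_digraph pot loopfree id_iso split[simplified] T_simps pair_ends
          cyclically_equivalent_refl simp flip: W_triv_def)
  qed
  with right reduced show ?thesis
    unfolding is_reduced_part_def by (intro conjI exI[of _ "(T, W_triv)"]) (simp_all add: T_simps)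
qed

end

section \<open>From the families of a maximal matching to the sets \<open>P\<close> and
  \<open>G\<close>\<close>

theorem theorem3:
  fixes Q :: "('v, 'a) pre_digraph"
    and k :: 'v
    and C' :: "'v \<Rightarrow> 'v \<Rightarrow> ('a \<times> 'a) set"
    and \<Gamma>' :: "'v \<Rightarrow> 'v \<Rightarrow> 'a set"
    and m :: "'a \<times> 'a \<Rightarrow> 'a"
    and S :: "('v, 'a, 'k::field) series"
  defines "P \<equiv> matched Q k C'"
    and "G \<equiv> matched Q k \<Gamma>'"
  assumes "fin_digraph Q" and "loopfree_digraph Q" and "no_two_cycles Q"
    and "k \<in> verts Q"
    and "maximal_matching Q k C' \<Gamma>' m"
    and "potential Q S"
    and "no_term_starts_at k S"
    and "\<And>u w \<alpha> \<beta>. S (u, w) \<noteq> 0 \<Longrightarrow> (\<alpha>, \<beta>) \<in> P \<Longrightarrow> \<not> sublist [\<alpha>, \<beta>] w"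
  shows "is_mutation k
    (Q, (\<Sum>\<gamma>\<in>G. path_elem Q [partner_in P m \<gamma>, partner_out P m \<gamma>, \<gamma>]) + S)
    (mutation_quiver Q k P G,
     (\<Sum>(\<alpha>, \<beta>)\<in>through Q k - P.
        path_elem (mutation_quiver Q k P G) [Comp \<alpha> \<beta>, Star \<beta>, Star \<alpha>])
      + star_potential Q k P G m S)"
proof -
  interpret fin_digraph Q by fact
  interpret loopfree_digraph Q by fact
  have C': "C' i j \<subseteq> through_from_to Q k i j" "bij_betw m (C' i j) (\<Gamma>' i j)"
    "\<Gamma>' i j \<subseteq> arrows_from_to Q j i"
    "card (\<Gamma>' i j) = min (card (through_from_to Q k i j)) (card (arrows_from_to Q j i))"
    "card (C' i j) = min (card (through_from_to Q k i j)) (card (arrows_from_to Q j i))"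
    if "i \<in> verts Q - {k}" "j \<in> verts Q - {k}" for i j
    using \<open>maximal_matching Q k C' \<Gamma>' m\<close> that by (auto simp: maximal_matching_def matching_def)
  have P: "\<exists>i\<in>verts Q - {k}. \<exists>j\<in>verts Q - {k}. p \<in> C' i j \<and> p \<in> through_from_to Q k i j \<and>
      m p \<in> \<Gamma>' i j \<and> m p \<in> arrows_from_to Q j i" if "p \<in> P" for p
  proof -
    from that obtain i j where ij: "i \<in> verts Q - {k}" "j \<in> verts Q - {k}" "p \<in> C' i j"
      by (auto simp: P_def matched_def)
    then show ?thesis using C'(1,2,3)[OF ij(1,2)]
      by (intro bexI[of _ i] bexI[of _ j]) (auto simp: bij_betw_def)
  qed
  have "matched_vertex Q k P G m"
  proof unfold_locales
    show "no_two_cycles Q" by fact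
    show "P \<subseteq> through Q k"
      using P by (fastforce simp: through_from_to_def)
    show "\<gamma> \<in> arcs Q \<and> tail Q \<gamma> \<noteq> k \<and> head Q \<gamma> \<noteq> k" if "\<gamma> \<in> G" for \<gamma>
      using that C'(3) by (fastforce simp: G_def matched_def arrows_from_to_def)
    show "bij_betw m P G"
    proof (rule bij_betw_imageI)
      show "m ` P = G"
        using C'(2) unfolding P_def G_def matched_def bij_betw_def by (auto simp: image_UN)
      show "inj_on m P"
      proof (rule inj_onI)
        fix p q assume "p \<in> P" "q \<in> P" "m p = m q"
        \<comment> \<open>The endpoints of the common image determine \<open>i\<close> and
          \<open>j\<close>, so both pairs lie in one \<open>C' i j\<close>, where \<open>m\<close>
          is injective.\<close>
        from P[OF this(1)] P[OF this(2)] this(3) obtain i j where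
          "i \<in> verts Q - {k}" "j \<in> verts Q - {k}" "p \<in> C' i j" "q \<in> C' i j"
          by (auto simp: arrows_from_to_def)
        with C'(2)[of i j] \<open>m p = m q\<close> show "p = q" by (auto simp: bij_betw_def inj_on_def)
      qed
    qed
    show "tail Q (m (\<alpha>, \<beta>)) = head Q \<beta> \<and> head Q (m (\<alpha>, \<beta>)) = tail Q \<alpha>" if "(\<alpha>, \<beta>) \<in> P" for \<alpha> \<beta>
      using P[OF that] by (auto simp: arrows_from_to_def through_from_to_def)
    show "c \<in> G" if "(\<alpha>, \<beta>) \<in> through Q k - P" "c \<in> arcs Q" "tail Q c = head Q \<beta>" "head Q c = tail Q \<alpha>"
      for \<alpha> \<beta> c
    proof -
      let ?i = "tail Q \<alpha>" and ?j = "head Q \<beta>"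
      have ends: "?i \<in> verts Q - {k}" "?j \<in> verts Q - {k}"
        using that(1) no_loops[of \<alpha>] no_loops[of \<beta>] by (auto simp: through_def)
      have fin: "finite (through_from_to Q k ?i ?j)" "finite (arrows_from_to Q ?j ?i)"
        by (rule finite_subset[of _ "arcs Q \<times> arcs Q"], auto simp: through_from_to_def through_def)
          (auto simp: arrows_from_to_def)
      \<comment> \<open>One unmatched pair makes \<open>C' ?i ?j\<close> a proper subset, so the
        minimum is attained by the number of arrows back; hence all of these are matched.\<close>
      have "(\<alpha>, \<beta>) \<in> through_from_to Q k ?i ?j - C' ?i ?j"
        using that(1) ends by (auto simp: through_from_to_def P_def matched_def)
      then have "C' ?i ?j \<subset> through_from_to Q k ?i ?j"
        using C'(1)[OF ends] by auto
      then have "card (C' ?i ?j) < card (through_from_to Q k ?i ?j)"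
        by (rule psubset_card_mono[OF fin(1)])
      then have "card (\<Gamma>' ?i ?j) = card (arrows_from_to Q ?j ?i)"
        using C'(4,5)[OF ends] by simp
      then have "\<Gamma>' ?i ?j = arrows_from_to Q ?j ?i"
        using C'(3)[OF ends] fin(2) by (intro card_subset_eq)
      then show "c \<in> G"
        using that(2-4) ends by (auto simp: G_def matched_def arrows_from_to_def)
    qed
  qed
  then interpret matched_vertex Q k P G m .
  have S: "awalk u w u \<and> 2 \<le> length w" if "S (u, w) \<noteq> 0" for u w
    using \<open>potential Q S\<close> that by (auto simp: potential_def cycles_of_length_ge_def)
  interpret matched_potential Q k P G m S
    by unfold_locales (use S \<open>no_term_starts_at k S\<close> assms(10) in \<open>auto simp: no_term_starts_at_def\<close>)
  let ?W = "(\<Sum>\<gamma>\<in>G. path_elem Q [pin \<gamma>, pout \<gamma>, \<gamma>]) + S"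
  have W: "awalk u w u \<and> 2 \<le> length w \<and> u \<noteq> k" if nonzero: "?W (u, w) \<noteq> 0" for u w
  proof (cases "S (u, w) = 0")
    case True
    with nonzero obtain \<gamma> where \<gamma>: "\<gamma> \<in> G" "u = tail Q (pin \<gamma>)" "w = [pin \<gamma>, pout \<gamma>, \<gamma>]"
      by (auto elim!: sum_path_elem_nonzeroE)
    with partners[OF \<gamma>(1)] G_arcs[OF \<gamma>(1)] no_loops[of "pin \<gamma>"] show ?thesis
      by (auto simp: awalk_simps)
  next
    case False
    with S S_start show ?thesis by auto
  qed
  then have "is_qp (Q, ?W)" "no_term_starts_at k ?W"
    by (auto simp: fin_digraph potential_def cycles_of_length_ge_def no_term_starts_at_def simp del: plus_fun_apply)
  moreover have "is_reduced_part (premutation k (Q, ?W)) (M, W_red)"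
    by (rule is_reduced_part_premutation)
  ultimately show ?thesis
    unfolding is_mutation_def by (simp add: path_elem_def)
qed

end
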